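(* Let $\xi$ be a boundedly exchangeable graph process on $S$ directed by $\nu$ and connected by a connection kernel $W:S^2\to[0,1]$. Let $B,C\subseteq S$ be disjoint bounded Borel sets such that $\mathbb{P}(\nu(B)=0)<1$, and let $f_{B\cup C}$ be a sampling function for $\xi$ on $B\cup C$. Then, defining $T_B:[0,1]\to[0,1]$ by $$T_B(x):=\inf\left\{y\in[0,1]\,\middle|\,\frac{\lambda\left(f_{B\cup C}^{-1}(B)\cap[0,y]\right)}{\lambda\left(f_{B\cup C}^{-1}(B)\right)}\ge x\right\},$$ where $\lambda$ is Lebesgue measure, the composition $f_{B\cup C}\circ T_B$ is a sampling function for $\xi$ on $B$.
   Context: Let $(S,d)$ be a complete separable metric space; "bounded" means bounded for $d$. A measure is locally finite if it is finite on bounded Borel sets (on $S^2\times\{0,1\}$, bounded for a $p$-product metric of $d$ and the discrete metric on $\{0,1\}$), and simple if it is a locally finite countable sum of distinct unit point masses. An adjacency measure on $S$ is a simple measure $\xi$ on $S^2\times\{0,1\}$ such that there is a simple measure $\nu$ on $S$ with $\xi(D\times\{0,1\})=\nu^{\otimes2}(D)$ for all Borel $D\subseteq S^2$, and $\xi$ is invariant under $(x,y,a)\mapsto(y,x,a)$; $\xi$ is said to be directed by the (unique) $\nu$. A random adjacency measure is a random measure on $S^2\times\{0,1\}$ that is a.s. an adjacency measure. For Borel $B\subseteq S$, $\xi|_B$ is the restriction of $\xi$ to $B\times B\times\{0,1\}$. A connection kernel is a symmetric measurable function $W:S^2\to[0,1]$. A graph process connected by $W$ is a random adjacency measure admitting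 a representation $\xi\overset{a.s.}{=}\sum_{i,j\le N}\delta_{(S_i,S_j,A_{ij})}$, with $N$ a random variable in $\{0,1,\dots\}\cup\{\infty\}$, $(S_i)$ a.s. distinct random elements of $S$, and, conditionally on $(N,(S_k))$, $A_{ii}=0$, $A_{ij}$ ($i<j$) independent $\mathrm{Bernoulli}(W(S_i,S_j))$, $A_{ji}=A_{ij}$. It is an i.i.d. representation if in addition the $(S_k)$ are i.i.d. and $N$ is independent of $(S_k)$. A mixed binomial process is a point process equal in law to $\sum_{i\le N}\delta_{S_i}$ with $N$ a $\{0,1,\dots\}$-valued random variable independent of an i.i.d. sequence $(S_i)$ in $S$. A mixed Poisson process is a point process that, conditionally on a random variable $\delta\ge0$, is a Poisson process with intensity measure $\delta\mu$, where $\mu$ is a locally finite measure on $S$. A graph process $\xi$ is boundedly exchangeable if it is directed by a mixed Poisson or mixed binomial process $\nu$ and, for every bounded Borel $B$ with $\mathbb{P}(\nu(B)=0)<1$, $\mathbb{P}(\nu(B)=n)>0$ for all $n\in\{1,2,\dots\}$. For such $\xi$ and a bounded Borel $B$ with $\mathbb{P}(\nu(B)=0)<1$, $\xi|_B$ admits an i.i.d. representation with vertex locations $(S_i)$ i.i.d. random elements of $B$; let $\eta_B$ denote their common law, a probability measure on $B$. A sampling function for $\xi$ on $B$ is a measurable function $f_B:[0,1]\to B$ such that $f_B(U)\sim\eta_B$ when $U$ is uniformly distributed on $[0,1]$.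
   Formalization: A sampling function on B is only required to take values in B almost everywhere, not at every point of [0,1]; pointwise the claim fails, since T_B(0)=0 and f_{B∪C}(0) may lie in C. *)

theory Defs
  imports "HOL-Probability.Probability" "HOL-Library.Extended_Nat"
begin

text \<open>
  The two-point space \<open>{0,1}\<close> of edge marks is represented by \<^typ>\<open>bool\<close> with the discrete
  metric, which makes \<open>('a \<times> 'a) \<times> bool\<close> a metric space under the Euclidean product metric.
\<close>

instantiation bool :: metric_space
begin

definition dist_bool :: "bool \<Rightarrow> bool \<Rightarrow> real" where
  "dist_bool a b = (if a = b then 0 else 1)"

definition uniformity_bool :: "(bool \<times> bool) filter" where
  "uniformity_bool = (INF e\<in>{0 <..}. principal {(x, y). dist x y < e})"

instance
proof
  fix U :: "bool set" and x y z :: bool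
  show "(uniformity :: (bool \<times> bool) filter)
      = (INF e\<in>{0 <..}. principal {(x, y). dist x y < e})"
    by (rule uniformity_bool_def)
  have "eventually (\<lambda>(x', y). x' = x \<longrightarrow> y \<in> U) uniformity" if "x \<in> U" for x
    unfolding uniformity_bool_def
    by (rule eventually_INF1[of 1])
       (use that in \<open>auto simp: eventually_principal dist_bool_def split: if_splits\<close>)
  then show "open U \<longleftrightarrow> (\<forall>x\<in>U. eventually (\<lambda>(x', y). x' = x \<longrightarrow> y \<in> U) uniformity)"
    using discrete_topology_class.open_discrete[of U] by blast
  show "dist x y = 0 \<longleftrightarrow> x = y"
    by (simp add: dist_bool_def)
  show "dist x y \<le> dist x z + dist y z"
    by (simp add: dist_bool_def)
qed

end

instance bool :: polish_space
proof
  fix X :: "nat \<Rightarrow> bool"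
  assume "Cauchy X"
  then obtain N where N: "\<And>m n. m \<ge> N \<Longrightarrow> n \<ge> N \<Longrightarrow> dist (X m) (X n) < 1"
    unfolding Cauchy_def using zero_less_one by blast
  have "X n = X N" if "n \<ge> N" for n
    using N[OF that order_refl] by (simp add: dist_bool_def split: if_splits)
  then have "eventually (\<lambda>n. X n = X N) sequentially"
    unfolding eventually_sequentially by blast
  then have "X \<longlonglongrightarrow> X N"
    by (rule tendsto_eventually)
  then show "convergent X"
    by (rule convergentI)
next
  have "countable (UNIV :: bool set set)"
    by (rule countable_finite) simp
  moreover have "open = generate_topology (UNIV :: bool set set)"
    by (intro ext iffI)
       (rule generate_topology.Basis, simp, rule discrete_topology_class.open_discrete)
  ultimately show "\<exists>B :: bool set set. countable B \<and> open = generate_topology B"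
    by blast
qed


subsection \<open>Random measures and point processes\<close>

definition locally_finite :: "'b::metric_space measure \<Rightarrow> bool" where
  "locally_finite \<mu> \<longleftrightarrow> sets \<mu> = sets borel \<and>
     (\<forall>A\<in>sets borel. bounded A \<longrightarrow> emeasure \<mu> A < \<infinity>)"

text \<open>\<open>\<Sum>\<^sub>i\<^sub>\<in>\<^sub>I \<delta>\<^bsub>x i\<^esub>\<close>, as the image of the counting measure on \<open>I\<close>.\<close>

definition sum_diracs :: "'i set \<Rightarrow> ('i \<Rightarrow> 'b::topological_space) \<Rightarrow> 'b measure" where
  "sum_diracs I x = distr (count_space I) borel x"

definition simple_measure :: "'b::metric_space measure \<Rightarrow> bool" where
  "simple_measure \<mu> \<longleftrightarrow> locally_finite \<mu> \<and> (\<exists>X. countable X \<and> \<mu> = sum_diracs X (\<lambda>x. x))"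

text \<open>
  The locally finite measures with the \<open>\<sigma>\<close>-algebra generated by the evaluations
  \<open>\<mu> \<mapsto> \<mu> A\<close> (the analogue of \<^const>\<open>subprob_algebra\<close>); the law of a random measure \<open>\<xi>\<close> on
  the probability space \<open>M\<close> is \<open>distr M locally_finite_algebra \<xi>\<close>.
\<close>

definition locally_finite_algebra :: "'b::metric_space measure measure" where
  "locally_finite_algebra =
     (SUP A\<in>sets borel. vimage_algebra {\<mu>. locally_finite \<mu>} (\<lambda>\<mu>. emeasure \<mu> A) borel)"

definition random_measure :: "'w measure \<Rightarrow> ('w \<Rightarrow> 'b::metric_space measure) \<Rightarrow> bool" where
  "random_measure M \<xi> \<longleftrightarrow> \<xi> \<in> measurable M locally_finite_algebra"

definition unit_lebesgue :: "real measure" where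
  "unit_lebesgue = restrict_space lborel {0..1}"

text \<open>
  Representations of random objects on \<open>M\<close> by further random variables are, as usual, understood
  on an extension of the probability space. Adjoining one independent uniform random variable is
  always sufficient, because the variables in question take values in Polish spaces. An object \<open>\<xi>\<close>
  on \<open>M\<close> becomes \<open>\<xi> \<circ> fst\<close> on the extension.
\<close>

definition extend_space :: "'w measure \<Rightarrow> ('w \<times> real) measure" where
  "extend_space M = M \<Otimes>\<^sub>M unit_lebesgue"

text \<open>Conditional probability of the event \<open>E\<close> given the random element \<open>X\<close> of \<open>K\<close>.\<close>

definition cond_prob_given ::
    "'w measure \<Rightarrow> 'b measure \<Rightarrow> ('w \<Rightarrow> 'b) \<Rightarrow> 'w set \<Rightarrow> 'w \<Rightarrow> real" where
  "cond_prob_given P K X E = real_cond_exp P (vimage_algebra (space P) X K) (indicator E)"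

text \<open>
  The right-hand side is the law of \<open>\<Sum>\<^sub>i\<^sub><\<^sub>n \<delta>\<^bsub>s i\<^esub>\<close> with \<open>n\<close> distributed as \<open>p\<close>
  and independent of the i.i.d. sequence \<open>s\<close> with common law \<open>\<eta>\<close>, on the canonical space.
\<close>

definition mixed_binomial_process :: "'w measure \<Rightarrow> ('w \<Rightarrow> 'a::polish_space measure) \<Rightarrow> bool" where
  "mixed_binomial_process M \<nu> \<longleftrightarrow> random_measure M \<nu> \<and>
     (\<exists>(p :: nat pmf) (\<eta> :: 'a measure). prob_space \<eta> \<and> sets \<eta> = sets borel \<and>
        distr M locally_finite_algebra \<nu> =
        distr (measure_pmf p \<Otimes>\<^sub>M (\<Pi>\<^sub>M i\<in>(UNIV :: nat set). \<eta>)) locally_finite_algebra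
          (\<lambda>(n, s). sum_diracs {..<n} s))"

text \<open>
  Conditionally on \<open>\<delta>\<close>, the counts of pairwise disjoint bounded Borel sets \<open>D i\<close> are independent
  and Poisson with means \<open>\<delta> \<mu>(D i)\<close>; the mean 0 gives the point mass at 0.
\<close>

definition mixed_poisson_process :: "'w measure \<Rightarrow> ('w \<Rightarrow> 'a::polish_space measure) \<Rightarrow> bool" where
  "mixed_poisson_process M \<nu> \<longleftrightarrow> random_measure M \<nu> \<and>
     (\<exists>\<delta> \<mu>. \<delta> \<in> borel_measurable (extend_space M) \<and>
        (\<forall>\<omega>\<in>space (extend_space M). 0 \<le> \<delta> \<omega>) \<and> locally_finite \<mu> \<and>
        (\<forall>(n :: nat) (D :: nat \<Rightarrow> 'a set) (k :: nat \<Rightarrow> nat).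
           (\<forall>i<n. D i \<in> sets borel \<and> bounded (D i)) \<and> disjoint_family_on D {..<n} \<longrightarrow>
           (AE \<omega> in extend_space M.
              cond_prob_given (extend_space M) borel \<delta>
                {\<omega>'\<in>space (extend_space M). \<forall>i<n. emeasure (\<nu> (fst \<omega>')) (D i) = of_nat (k i)} \<omega> =
              (\<Prod>i<n. exp (- (\<delta> \<omega> * measure \<mu> (D i))) *
                     (\<delta> \<omega> * measure \<mu> (D i)) ^ k i / fact (k i)))))"


subsection \<open>Graph processes\<close>

definition directed_by ::
    "(('a::polish_space \<times> 'a) \<times> bool) measure \<Rightarrow> 'a measure \<Rightarrow> bool" where
  "directed_by \<xi> \<nu> \<longleftrightarrow> simple_measure \<xi> \<and> simple_measure \<nu> \<and>
     (\<forall>D\<in>sets borel. emeasure \<xi> (D \<times> UNIV) = emeasure (\<nu> \<Otimes>\<^sub>M \<nu>) D) \<and>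
     distr \<xi> borel (\<lambda>((x, y), a). ((y, x), a)) = \<xi>"

definition adjacency_measure :: "(('a::polish_space \<times> 'a) \<times> bool) measure \<Rightarrow> bool" where
  "adjacency_measure \<xi> \<longleftrightarrow> (\<exists>\<nu>. directed_by \<xi> \<nu>)"

definition random_adjacency_measure ::
    "'w measure \<Rightarrow> ('w \<Rightarrow> (('a::polish_space \<times> 'a) \<times> bool) measure) \<Rightarrow> bool" where
  "random_adjacency_measure M \<xi> \<longleftrightarrow>
     random_measure M \<xi> \<and> (AE \<omega> in M. adjacency_measure (\<xi> \<omega>))"

text \<open>Restriction to \<open>B \<times> B \<times> {0,1}\<close>, regarded as a measure on the whole space.\<close>

definition restrict_adjacency ::
    "'a set \<Rightarrow> (('a::polish_space \<times> 'a) \<times> bool) measure \<Rightarrow> (('a \<times> 'a) \<times> bool) measure" where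
  "restrict_adjacency B \<xi> = density \<xi> (indicator ((B \<times> B) \<times> UNIV))"

definition connection_kernel :: "('a::polish_space \<times> 'a \<Rightarrow> real) \<Rightarrow> bool" where
  "connection_kernel W \<longleftrightarrow> W \<in> borel_measurable borel \<and>
     (\<forall>x y. W (x, y) = W (y, x)) \<and> (\<forall>x y. 0 \<le> W (x, y) \<and> W (x, y) \<le> 1)"

text \<open>
  A representation \<open>\<xi> = \<Sum>\<^sub>i\<^sub>,\<^sub>j\<^sub><\<^sub>N \<delta>\<^bsub>(S i, S j, A i j)\<^esub>\<close> a.s. on the probability
  space \<open>P\<close>, indexed from 0. The last conjunct says that the \<open>A i j\<close>, \<open>i < j\<close>, are conditionally
  independent Bernoulli variables with parameters \<open>W (S i, S j)\<close> given \<open>N\<close> and the sequence \<open>S\<close>.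
\<close>

definition graph_representation ::
    "'p measure \<Rightarrow> ('p \<Rightarrow> (('a::polish_space \<times> 'a) \<times> bool) measure) \<Rightarrow> ('a \<times> 'a \<Rightarrow> real) \<Rightarrow>
     ('p \<Rightarrow> enat) \<Rightarrow> (nat \<Rightarrow> 'p \<Rightarrow> 'a) \<Rightarrow> (nat \<Rightarrow> nat \<Rightarrow> 'p \<Rightarrow> bool) \<Rightarrow> bool" where
  "graph_representation P \<xi> W N S A \<longleftrightarrow>
     N \<in> measurable P (count_space UNIV) \<and>
     (\<forall>i. S i \<in> borel_measurable P) \<and>
     (\<forall>i j. A i j \<in> measurable P (count_space UNIV)) \<and>
     (AE \<omega> in P. \<xi> \<omega> = sum_diracs {(i, j). enat i < N \<omega> \<and> enat j < N \<omega>}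
                         (\<lambda>(i, j). ((S i \<omega>, S j \<omega>), A i j \<omega>))) \<and>
     (AE \<omega> in P. inj (\<lambda>i. S i \<omega>)) \<and>
     (AE \<omega> in P. \<forall>i. \<not> A i i \<omega>) \<and>
     (AE \<omega> in P. \<forall>i j. A j i \<omega> = A i j \<omega>) \<and>
     (\<forall>F (b :: nat \<times> nat \<Rightarrow> bool). finite F \<and> F \<subseteq> {(i, j). i < j} \<longrightarrow>
        (AE \<omega> in P.
           cond_prob_given P (count_space UNIV \<Otimes>\<^sub>M (\<Pi>\<^sub>M i\<in>UNIV. borel)) (\<lambda>\<omega>'. (N \<omega>', \<lambda>i. S i \<omega>'))
             {\<omega>'\<in>space P. \<forall>(i, j)\<in>F. A i j \<omega>' = b (i, j)} \<omega> =
           (\<Prod>(i, j)\<in>F. if b (i, j) then W (S i \<omega>, S j \<omega>) else 1 - W (S i \<omega>, S j \<omega>))))"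

definition graph_process ::
    "'w measure \<Rightarrow> ('w \<Rightarrow> (('a::polish_space \<times> 'a) \<times> bool) measure) \<Rightarrow> ('a \<times> 'a \<Rightarrow> real) \<Rightarrow> bool" where
  "graph_process M \<xi> W \<longleftrightarrow> random_adjacency_measure M \<xi> \<and>
     (\<exists>N S A. graph_representation (extend_space M) (\<xi> \<circ> fst) W N S A)"

definition iid_graph_representation ::
    "'p measure \<Rightarrow> ('p \<Rightarrow> (('a::polish_space \<times> 'a) \<times> bool) measure) \<Rightarrow> ('a \<times> 'a \<Rightarrow> real) \<Rightarrow>
     ('p \<Rightarrow> enat) \<Rightarrow> (nat \<Rightarrow> 'p \<Rightarrow> 'a) \<Rightarrow> (nat \<Rightarrow> nat \<Rightarrow> 'p \<Rightarrow> bool) \<Rightarrow> 'a measure \<Rightarrow> bool" where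
  "iid_graph_representation P \<xi> W N S A \<eta> \<longleftrightarrow>
     graph_representation P \<xi> W N S A \<and>
     prob_space.indep_vars P (\<lambda>_. borel) S UNIV \<and>
     (\<forall>i. distr P borel (S i) = \<eta>) \<and>
     prob_space.indep_set P
       (sets (vimage_algebra (space P) N (count_space UNIV)))
       (sets (vimage_algebra (space P) (\<lambda>\<omega> i. S i \<omega>) (\<Pi>\<^sub>M i\<in>UNIV. borel)))"

definition directing_process ::
    "'w measure \<Rightarrow> ('w \<Rightarrow> (('a::polish_space \<times> 'a) \<times> bool) measure) \<Rightarrow> ('w \<Rightarrow> 'a measure) \<Rightarrow> bool" where
  "directing_process M \<xi> \<nu> \<longleftrightarrow> random_measure M \<nu> \<and> (AE \<omega> in M. directed_by (\<xi> \<omega>) (\<nu> \<omega>))"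

definition boundedly_exchangeable ::
    "'w measure \<Rightarrow> ('w \<Rightarrow> (('a::polish_space \<times> 'a) \<times> bool) measure) \<Rightarrow> ('w \<Rightarrow> 'a measure) \<Rightarrow> bool" where
  "boundedly_exchangeable M \<xi> \<nu> \<longleftrightarrow> directing_process M \<xi> \<nu> \<and>
     (mixed_poisson_process M \<nu> \<or> mixed_binomial_process M \<nu>) \<and>
     (\<forall>B\<in>sets borel. bounded B \<and> \<P>(\<omega> in M. emeasure (\<nu> \<omega>) B = 0) < 1 \<longrightarrow>
        (\<forall>n\<ge>1. \<P>(\<omega> in M. emeasure (\<nu> \<omega>) B = of_nat n) > 0))"


subsection \<open>Sampling functions\<close>

text \<open>
  \<open>vertex_law M \<xi> W B \<eta>\<close> says that \<open>\<eta>\<close> is the common law \<open>\<eta>\<^sub>B\<close> of the vertex locations in an i.i.d.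
  representation of \<open>\<xi>|\<^sub>B\<close>. A law on \<open>B\<close> is represented by a law on the whole space giving \<open>B\<close> mass
  one. For a boundedly exchangeable \<open>\<xi>\<close> and bounded \<open>B\<close> with \<open>\<P>(\<nu>(B) = 0) < 1\<close>, there is exactly
  one such \<open>\<eta>\<close>; in particular \<open>\<eta>(D) = \<E>[\<nu>(D); \<nu>(B) = n] / (n \<P>(\<nu>(B) = n))\<close> for Borel \<open>D \<subseteq> B\<close>, \<open>n \<ge> 1\<close>.
\<close>

definition vertex_law ::
    "'w measure \<Rightarrow> ('w \<Rightarrow> (('a::polish_space \<times> 'a) \<times> bool) measure) \<Rightarrow> ('a \<times> 'a \<Rightarrow> real) \<Rightarrow>
     'a set \<Rightarrow> 'a measure \<Rightarrow> bool" where
  "vertex_law M \<xi> W B \<eta> \<longleftrightarrow> emeasure \<eta> B = 1 \<and>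
     (\<exists>N S A. iid_graph_representation (extend_space M) (restrict_adjacency B \<circ> \<xi> \<circ> fst) W N S A \<eta>)"

text \<open>
  The law of \<open>f(U)\<close> has mass one on \<open>B\<close>, so \<open>f\<close> takes its values in \<open>B\<close> almost everywhere on
  \<open>[0,1]\<close>. This is not required pointwise: \<open>f\<^bsub>B \<union> C\<^esub> \<circ> T\<^sub>B\<close> may leave \<open>B\<close> on a null set. For
  instance \<open>T\<^sub>B 0 = 0\<close> for every \<open>f\<^bsub>B \<union> C\<^esub>\<close>, including those with \<open>f\<^bsub>B \<union> C\<^esub> 0 \<in> C\<close>.
\<close>

definition sampling_function ::
    "'w measure \<Rightarrow> ('w \<Rightarrow> (('a::polish_space \<times> 'a) \<times> bool) measure) \<Rightarrow> ('a \<times> 'a \<Rightarrow> real) \<Rightarrow>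
     'a set \<Rightarrow> (real \<Rightarrow> 'a) \<Rightarrow> bool" where
  "sampling_function M \<xi> W B f \<longleftrightarrow> f \<in> borel_measurable unit_lebesgue \<and>
     vertex_law M \<xi> W B (distr unit_lebesgue borel f)"

definition T_map :: "(real \<Rightarrow> 'a) \<Rightarrow> 'a set \<Rightarrow> real \<Rightarrow> real" where
  "T_map f B x = Inf {y \<in> {0..1}.
     measure lborel ({u \<in> {0..1}. f u \<in> B} \<inter> {0..y}) / measure lborel {u \<in> {0..1}. f u \<in> B} \<ge> x}"

end

theory Submission
  imports Defs
begin

text \<open>
  Let \<open>\<eta>\<close> be the law of \<open>f(U)\<close> for a uniform \<open>U\<close>, that is, the law of the vertices of \<open>\<xi>\<close> in
  \<open>B \<union> C\<close>. Two facts give the theorem.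

  First, \<open>T_map f B\<close> is the quantile function of the uniform law on the set of \<open>u \<in> [0,1]\<close> with
  \<open>f u \<in> B\<close>. Therefore \<open>T_map f B\<close> transports Lebesgue measure to this law, and \<open>f \<circ> T_map f B\<close>
  transports it to the conditional law \<open>\<eta>(\<cdot> | B)\<close> (\<open>distr_comp_T_map\<close>).

  Second, \<open>\<eta>(\<cdot> | B)\<close> is a vertex law of \<open>\<xi>\<close> on \<open>B\<close> (\<open>vertex_law_uniform_measure\<close>). From an i.i.d.
  representation \<open>N\<close>, \<open>S\<close>, \<open>A\<close> of the restriction of \<open>\<xi>\<close> to \<open>B \<union> C\<close>, a representation of the restriction to
  \<open>B\<close> is read off on the same probability space: its vertices are the successive terms of the
  infinite sequence \<open>S\<close> in \<open>B\<close>, their number is the number of visits to \<open>B\<close> before \<open>N\<close>, and the marks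
  are those of \<open>A\<close> at the visit times. The visits are i.i.d. with law \<open>\<eta>(\<cdot> | B)\<close> and independent of
  their number, because resampling the visits of an i.i.d. sequence independently from \<open>\<eta>(\<cdot> | B)\<close>
  changes neither its law nor the visit times (\<open>distr_resample\<close>). The conditional law of the marks is
  found by fixing the values of the visit times (\<open>cond_prob_given_visits\<close>).

  Conditioning on \<open>B\<close> makes sense because \<open>\<eta> B > 0\<close>: otherwise \<open>\<nu>(B) = 0\<close> almost surely
  (\<open>vertex_law_pos\<close>).
\<close>

section \<open>Visits of a sequence to a set\<close>

definition visits_before :: "'a set \<Rightarrow> (nat \<Rightarrow> 'a) \<Rightarrow> nat \<Rightarrow> nat" where
  "visits_before B s i = card {k. k < i \<and> s k \<in> B}"

text \<open>
  The index of the \<open>j\<close>-th visit, counted from 0. The value is arbitrary if the sequence has at most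
  \<open>j\<close> visits to \<open>B\<close>; all uses are on the event of infinitely many visits.
\<close>

definition visit_time :: "'a set \<Rightarrow> (nat \<Rightarrow> 'a) \<Rightarrow> nat \<Rightarrow> nat" where
  "visit_time B s j = (LEAST i. s i \<in> B \<and> visits_before B s i = j)"

definition visits :: "'a set \<Rightarrow> (nat \<Rightarrow> 'a) \<Rightarrow> nat \<Rightarrow> 'a" where
  "visits B s j = s (visit_time B s j)"

text \<open>
  The number of visits before time \<open>n\<close>. The value \<open>\<infinity>\<close> at \<open>n = \<infinity>\<close> is the true count exactly when
  there are infinitely many visits.
\<close>

definition visit_count :: "'a set \<Rightarrow> enat \<Rightarrow> (nat \<Rightarrow> 'a) \<Rightarrow> enat" where
  "visit_count B n s = (case n of enat k \<Rightarrow> enat (visits_before B s k) | \<infinity> \<Rightarrow> \<infinity>)"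

text \<open>
  The coupling behind the independence proof: the points of \<open>s\<close> outside \<open>B\<close> stay, and the visits
  of \<open>s\<close> to \<open>B\<close> are replaced, in order, by the points of \<open>t\<close>.
\<close>

definition resample :: "'a set \<Rightarrow> (nat \<Rightarrow> 'a) \<Rightarrow> (nat \<Rightarrow> 'a) \<Rightarrow> nat \<Rightarrow> 'a" where
  "resample B s t i = (if s i \<in> B then t (visits_before B s i) else s i)"

lemma visits_before_mono: "i \<le> j \<Longrightarrow> visits_before B s i \<le> visits_before B s j"
  unfolding visits_before_def by (intro card_mono) auto

lemma visits_before_less:
  assumes "s i \<in> B" "i < j"
  shows "visits_before B s i < visits_before B s j"
  unfolding visits_before_def by (intro psubset_card_mono) (use assms in auto)

lemma inj_on_visits_before: "inj_on (visits_before B s) {i. s i \<in> B}"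
  by (rule inj_onI) (metis (mono_tags, lifting) mem_Collect_eq nat_neq_iff visits_before_less)

lemma visit_time_visits_before:
  assumes "s i \<in> B"
  shows "visit_time B s (visits_before B s i) = i"
  unfolding visit_time_def
  by (rule Least_equality) (use assms inj_on_visits_before[of B s] in \<open>auto simp: inj_on_def\<close>)

lemma
  assumes "infinite {i. s i \<in> B}"
  shows visit_time_in: "s (visit_time B s j) \<in> B"
    and visits_before_visit_time: "visits_before B s (visit_time B s j) = j"
proof -
  let ?X = "{i. s i \<in> B}" and ?e = "enumerate {i. s i \<in> B}"
  have "{k. k < ?e j \<and> s k \<in> B} = ?e ` {..<j}"
  proof (intro equalityI subsetI)
    fix k assume k: "k \<in> {k. k < ?e j \<and> s k \<in> B}"
    then obtain l where "k = ?e l"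
      using range_enumerate[OF assms] by (metis (mono_tags, lifting) imageE mem_Collect_eq)
    with k show "k \<in> ?e ` {..<j}"
      using assms by auto
  next
    fix k assume "k \<in> ?e ` {..<j}"
    then show "k \<in> {k. k < ?e j \<and> s k \<in> B}"
      using enumerate_in_set[OF assms] assms by (auto intro: enumerate_mono)
  qed
  moreover have "inj_on ?e {..<j}"
    using enumerate_mono[OF _ assms] by (intro strict_mono_on_imp_inj_on strict_mono_onI) auto
  ultimately have "visits_before B s (?e j) = j"
    by (simp add: visits_before_def card_image)
  moreover have "s (?e j) \<in> B"
    using enumerate_in_set[OF assms] by auto
  ultimately have *: "s (visit_time B s j) \<in> B \<and> visits_before B s (visit_time B s j) = j"
    unfolding visit_time_def by (intro LeastI) auto
  then show "s (visit_time B s j) \<in> B" "visits_before B s (visit_time B s j) = j"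
    by auto
qed

lemma visit_time_less_iff:
  assumes "infinite {i. s i \<in> B}"
  shows "visit_time B s j < n \<longleftrightarrow> j < visits_before B s n"
  using visits_before_less[of s "visit_time B s j" B n, OF visit_time_in[of s B j, OF assms]]
    visits_before_mono[of n "visit_time B s j" B s] visits_before_visit_time[OF assms, of j]
  by (metis leD leI)

lemma strict_mono_visit_time:
  assumes "infinite {i. s i \<in> B}"
  shows "strict_mono (visit_time B s)"
  by (rule strict_monoI) (simp add: visit_time_less_iff visits_before_visit_time assms)

text \<open>
  The vertices of index less than \<open>n\<close> that lie in \<open>B\<close> are thus enumerated without gaps by the
  first \<open>visit_count B n s\<close> visits.
\<close>

lemma visit_time_less_count_iff:
  assumes "infinite {i. s i \<in> B}"
  shows "enat (visit_time B s j) < n \<longleftrightarrow> enat j < visit_count B n s"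
  by (cases n) (simp_all add: visit_count_def visit_time_less_iff[OF assms])

text \<open>
  If all points of \<open>t\<close> lie in \<open>B\<close>, resampling moves no visit in time. The visit counts of the
  resampled sequence therefore depend on \<open>s\<close> alone, and its visits are \<open>t\<close> itself.
\<close>

lemma
  assumes "\<And>j. t j \<in> B"
  shows visit_count_resample: "visit_count B n (resample B s t) = visit_count B n s"
    and visits_resample: "infinite {i. s i \<in> B} \<Longrightarrow> visits B (resample B s t) = t"
proof -
  have ind: "resample B s t i \<in> B \<longleftrightarrow> s i \<in> B" for i
    using assms by (simp add: resample_def)
  have visits_before: "visits_before B (resample B s t) i = visits_before B s i" for i
    by (simp add: visits_before_def ind)
  have time: "visit_time B (resample B s t) = visit_time B s"
    by (simp add: fun_eq_iff visit_time_def visits_before ind)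
  show "visit_count B n (resample B s t) = visit_count B n s"
    by (simp add: visit_count_def visits_before split: enat.split)
  show "visits B (resample B s t) = t" if "infinite {i. s i \<in> B}"
    by (simp add: fun_eq_iff visits_def time resample_def visit_time_in visits_before_visit_time that)
qed

lemma measurable_visits_before [measurable (raw)]:
  assumes [measurable]: "B \<in> sets M" "X \<in> measurable N (\<Pi>\<^sub>M i\<in>(UNIV::nat set). M)"
  shows "(\<lambda>x. visits_before B (X x) i) \<in> measurable N (count_space UNIV)"
proof -
  have "visits_before B s i = (\<Sum>k<i. if s k \<in> B then 1 else 0)" for s
  proof -
    have "{k. k < i \<and> s k \<in> B} = {..<i} \<inter> {k. s k \<in> B}"
      by auto
    then show ?thesis
      by (simp add: visits_before_def sum.If_cases)
  qed
  then show ?thesis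
    by simp
qed

lemma measurable_visit_time [measurable (raw)]:
  assumes [measurable]: "B \<in> sets M" "X \<in> measurable N (\<Pi>\<^sub>M i\<in>(UNIV::nat set). M)"
  shows "(\<lambda>x. visit_time B (X x) j) \<in> measurable N (count_space UNIV)"
  unfolding visit_time_def by measurable

lemma measurable_visits [measurable (raw)]:
  assumes [measurable]: "B \<in> sets M" "X \<in> measurable N (\<Pi>\<^sub>M i\<in>(UNIV::nat set). M)"
  shows "(\<lambda>x. visits B (X x)) \<in> measurable N (\<Pi>\<^sub>M i\<in>(UNIV::nat set). M)"
proof (rule measurable_PiM_single')
  fix j :: nat
  show "(\<lambda>x. visits B (X x) j) \<in> measurable N M"
    unfolding visits_def
    by (rule measurable_compose_countable[where f = "\<lambda>i x. X x i"]) measurable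
next
  show "(\<lambda>x. visits B (X x)) \<in> space N \<rightarrow> (\<Pi>\<^sub>E i\<in>UNIV. space M)"
    using measurable_space[OF assms(2)] by (auto simp: visits_def space_PiM PiE_iff)
qed

lemma measurable_visit_count [measurable (raw)]:
  assumes [measurable]: "B \<in> sets M" "X \<in> measurable N (\<Pi>\<^sub>M i\<in>(UNIV::nat set). M)"
    "K \<in> measurable N (count_space UNIV)"
  shows "(\<lambda>x. visit_count B (K x) (X x)) \<in> measurable N (count_space UNIV)"
  unfolding visit_count_def
proof (rule measurable_compose_countable[where f = "\<lambda>n x. case n of enat k \<Rightarrow> enat (visits_before B (X x) k) | \<infinity> \<Rightarrow> \<infinity>"
    and g = K])
  show "(\<lambda>x. case n of enat k \<Rightarrow> enat (visits_before B (X x) k) | \<infinity> \<Rightarrow> \<infinity>) \<in> measurable N (count_space UNIV)" for n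
    by (cases n) simp_all
qed simp

lemma measurable_resample [measurable (raw)]:
  assumes [measurable]: "B \<in> sets M" "X \<in> measurable N (\<Pi>\<^sub>M i\<in>(UNIV::nat set). M)"
    "Y \<in> measurable N (\<Pi>\<^sub>M i\<in>(UNIV::nat set). M)"
  shows "(\<lambda>x. resample B (X x) (Y x)) \<in> measurable N (\<Pi>\<^sub>M i\<in>(UNIV::nat set). M)"
proof (rule measurable_PiM_single')
  fix i :: nat
  have "(\<lambda>x. Y x (visits_before B (X x) i)) \<in> measurable N M"
    by (rule measurable_compose_countable[where f = "\<lambda>j x. Y x j"]) measurable
  then show "(\<lambda>x. resample B (X x) (Y x) i) \<in> measurable N M"
    unfolding resample_def by measurable
next
  show "(\<lambda>x. resample B (X x) (Y x)) \<in> space N \<rightarrow> (\<Pi>\<^sub>E i\<in>UNIV. space M)"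
    using measurable_space[OF assms(2)] measurable_space[OF assms(3)]
    by (auto simp: resample_def space_PiM PiE_iff)
qed

section \<open>Visits of an i.i.d. sequence\<close>

text \<open>
  The probability of avoiding \<open>B\<close> during \<open>m\<close> successive steps is \<open>(1 - \<eta> B) ^ m\<close>, which tends to 0.
\<close>

lemma AE_infinite_visits:
  assumes "prob_space \<eta>" and [measurable]: "B \<in> sets \<eta>" and pos: "emeasure \<eta> B \<noteq> 0"
  shows "AE s in (\<Pi>\<^sub>M i\<in>(UNIV::nat set). \<eta>). infinite {i. s i \<in> B}"
proof -
  interpret eta: prob_space \<eta> by fact
  interpret Q: product_prob_space "\<lambda>_. \<eta>" "UNIV :: nat set"
    by unfold_locales
  let ?Q = "\<Pi>\<^sub>M i\<in>(UNIV::nat set). \<eta>" and ?q = "measure \<eta> (space \<eta> - B)"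
  have q: "?q < 1"
    using pos by (simp add: eta.prob_compl eta.emeasure_eq_measure)
      (metis measure_nonneg order_le_less)
  have "AE s in ?Q. \<exists>i\<ge>n. s i \<in> B" for n
  proof -
    let ?Z = "{s \<in> space ?Q. \<forall>i\<ge>n. s i \<notin> B}"
    have "measure ?Q ?Z \<le> ?q ^ m" for m
    proof -
      have meas: "{s \<in> space ?Q. \<forall>i\<in>{n..<n+m}. s i \<in> space \<eta> - B} \<in> sets ?Q"
        by measurable
      have "measure ?Q ?Z \<le> measure ?Q {s \<in> space ?Q. \<forall>i\<in>{n..<n+m}. s i \<in> space \<eta> - B}"
        by (intro Q.P.finite_measure_mono[OF _ meas]) (auto simp: space_PiM PiE_iff)
      also have "ennreal \<dots> = (\<Prod>i\<in>{n..<n+m}. emeasure \<eta> (space \<eta> - B))"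
        by (subst Q.P.emeasure_eq_measure[symmetric], rule Q.emeasure_PiM_Collect) auto
      then have "measure ?Q {s \<in> space ?Q. \<forall>i\<in>{n..<n+m}. s i \<in> space \<eta> - B} = ?q ^ m"
        by (simp add: eta.emeasure_eq_measure ennreal_power)
      finally show ?thesis .
    qed
    moreover have "(\<lambda>m. ?q ^ m) \<longlonglongrightarrow> 0"
      using q by (intro LIMSEQ_realpow_zero) auto
    ultimately have "measure ?Q ?Z \<le> 0"
      by (intro LIMSEQ_le_const) auto
    then have "?Z \<in> null_sets ?Q"
      by (intro null_setsI) (auto simp: Q.P.emeasure_eq_measure measure_le_0_iff)
    then show ?thesis
      by (rule AE_I') auto
  qed
  then have "AE s in ?Q. \<forall>n. \<exists>i\<ge>n. s i \<in> B"
    by (simp add: AE_all_countable)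
  then show ?thesis
    by eventually_elim (simp add: infinite_nat_iff_unbounded_le)
qed

text \<open>
  Given \<open>s\<close>, distinct visit times use distinct entries of \<open>t\<close>, so the coordinates of the resampled
  sequence are independent: the \<open>i\<close>-th one is a fresh point with the conditional law of \<open>\<eta>\<close> on \<open>B\<close>
  if \<open>s i \<in> B\<close>, and is \<open>s i\<close> otherwise. Averaging over the independent \<open>s i\<close> keeps independence,
  and gives each coordinate the law \<open>\<eta>\<close>, because replacing a point in \<open>B\<close> by an independent
  point with the conditional law on \<open>B\<close> does not change its distribution.
\<close>

lemma distr_resample:
  assumes "prob_space \<eta>" and [measurable]: "B \<in> sets \<eta>" and pos: "emeasure \<eta> B \<noteq> 0"
  shows "distr ((\<Pi>\<^sub>M i\<in>(UNIV::nat set). \<eta>) \<Otimes>\<^sub>M (\<Pi>\<^sub>M i\<in>UNIV. uniform_measure \<eta> B))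
      (\<Pi>\<^sub>M i\<in>UNIV. \<eta>) (\<lambda>(s, t). resample B s t) = (\<Pi>\<^sub>M i\<in>UNIV. \<eta>)"
proof -
  interpret eta: prob_space \<eta> by fact
  interpret etaB: prob_space "uniform_measure \<eta> B"
    by (rule prob_space_uniform_measure[OF pos]) simp
  interpret Q: product_prob_space "\<lambda>_. \<eta>" "UNIV :: nat set"
    by unfold_locales
  interpret R: product_prob_space "\<lambda>_. uniform_measure \<eta> B" "UNIV :: nat set"
    by unfold_locales
  let ?Q = "\<Pi>\<^sub>M i\<in>(UNIV::nat set). \<eta>" and ?R = "\<Pi>\<^sub>M i\<in>(UNIV::nat set). uniform_measure \<eta> B"
  have sets_R [measurable_cong]: "sets ?R = sets ?Q"
    by (intro sets_PiM_cong) auto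
  have space_R: "space ?R = space ?Q"
    by (rule sets_eq_imp_space_eq[OF sets_R])
  have [measurable]: "(\<lambda>(s, t). resample B s t) \<in> ?Q \<Otimes>\<^sub>M ?R \<rightarrow>\<^sub>M ?Q"
    by measurable
  have indep: "Q.P.indep_vars (\<lambda>_. \<eta>) (\<lambda>i s. s i) UNIV"
    by (subst Q.P.indep_vars_iff_distr_eq_PiM)
      (auto simp: restrict_UNIV Q.PiM_component distr_id2)
  show ?thesis
  proof (rule Q.PiM_eq)
    fix J :: "nat set" and F :: "nat \<Rightarrow> 'a set"
    assume J: "finite J" "J \<subseteq> UNIV" and F: "\<And>j. j \<in> J \<Longrightarrow> F j \<in> sets \<eta>"
    \<comment> \<open>The conditional probability, given \<open>s i = x\<close>, that coordinate \<open>i\<close> of the resampled sequence is in \<open>F i\<close>.\<close>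
    define g where "g i x = (if x \<in> B then emeasure (uniform_measure \<eta> B) (F i) else indicator (F i) x)"
      for i x
    have g_meas [measurable]: "g i \<in> borel_measurable \<eta>" if "i \<in> J" for i
      unfolding g_def using F[OF that] by measurable
    let ?E = "{x \<in> space (?Q \<Otimes>\<^sub>M ?R). \<forall>i\<in>J. resample B (fst x) (snd x) i \<in> F i}"
    have E: "?E \<in> sets (?Q \<Otimes>\<^sub>M ?R)"
    proof (intro sets.sets_Collect_finite_All J)
      fix i assume "i \<in> J"
      then have [measurable]: "F i \<in> sets \<eta>" by (rule F)
      have "(\<lambda>x. resample B (fst x) (snd x) i) \<in> ?Q \<Otimes>\<^sub>M ?R \<rightarrow>\<^sub>M \<eta>"
        by (rule measurable_compose[OF _ measurable_component_singleton[of i UNIV]]) simp_all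
      then show "{x \<in> space (?Q \<Otimes>\<^sub>M ?R). resample B (fst x) (snd x) i \<in> F i} \<in> sets (?Q \<Otimes>\<^sub>M ?R)"
        by measurable
    qed
    have inner: "emeasure ?R {t \<in> space ?R. \<forall>i\<in>J. resample B s t i \<in> F i} = (\<Prod>i\<in>J. g i (s i))"
      for s
    proof (cases "\<exists>i\<in>J. s i \<notin> B \<and> s i \<notin> F i")
      case True
      then obtain i where i: "i \<in> J" "s i \<notin> B" "s i \<notin> F i" by auto
      then have "{t \<in> space ?R. \<forall>i\<in>J. resample B s t i \<in> F i} = {}"
        by (auto simp: resample_def)
      moreover have "(\<Prod>i\<in>J. g i (s i)) = 0"
        using i J by (intro prod_zero) (auto simp: g_def)
      ultimately show ?thesis by (simp only: emeasure_empty)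
    next
      case False
      let ?J = "{i \<in> J. s i \<in> B}" and ?r = "visits_before B s"
      have inj: "inj_on ?r ?J"
        by (rule inj_on_subset[OF inj_on_visits_before]) auto
      have "{t \<in> space ?R. \<forall>i\<in>J. resample B s t i \<in> F i} =
          {t \<in> space ?R. \<forall>j\<in>?r ` ?J. t j \<in> F (visit_time B s j)}"
        \<comment> \<open>Coordinates outside \<open>B\<close> satisfy their constraint; the visits constrain the entries of \<open>t\<close> at their ranks.\<close>
        using False by (auto simp: resample_def visit_time_visits_before)
      also have "emeasure ?R \<dots> = (\<Prod>j\<in>?r ` ?J. emeasure (uniform_measure \<eta> B) (F (visit_time B s j)))"
        using J by (intro R.emeasure_PiM_Collect) (auto simp: visit_time_visits_before F)
      also have "\<dots> = (\<Prod>i\<in>?J. emeasure (uniform_measure \<eta> B) (F i))"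
        by (simp add: prod.reindex[OF inj] visit_time_visits_before)
      also have "\<dots> = (\<Prod>i\<in>?J. g i (s i))"
        by (intro prod.cong) (auto simp: g_def)
      also have "\<dots> = (\<Prod>i\<in>J. g i (s i))"
        using J False by (intro prod.mono_neutral_left) (auto simp: g_def)
      finally show ?thesis .
    qed
    have single: "(\<integral>\<^sup>+x. g i x \<partial>\<eta>) = emeasure \<eta> (F i)" if "i \<in> J" for i
    proof -
      note [measurable] = F[OF that]
      have "(\<integral>\<^sup>+x. g i x \<partial>\<eta>) = (\<integral>\<^sup>+x. emeasure (uniform_measure \<eta> B) (F i) * indicator B x +
          indicator (F i - B) x \<partial>\<eta>)"
        by (intro nn_integral_cong) (auto simp: g_def split: split_indicator)
      also have "\<dots> = emeasure \<eta> (B \<inter> F i) / emeasure \<eta> B * emeasure \<eta> B + emeasure \<eta> (F i - B)"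
        by (subst nn_integral_add) (auto simp: nn_integral_cmult)
      also have "emeasure \<eta> (B \<inter> F i) / emeasure \<eta> B * emeasure \<eta> B = emeasure \<eta> (B \<inter> F i)"
        using pos by (simp add: ennreal_divide_times ennreal_times_divide eta.emeasure_eq_measure
            divide_ennreal ennreal_mult''[symmetric])
      also have "emeasure \<eta> (B \<inter> F i) + emeasure \<eta> (F i - B) = emeasure \<eta> (F i)"
        by (subst plus_emeasure) (auto intro!: arg_cong[where f="emeasure \<eta>"])
      finally show ?thesis .
    qed
    have "emeasure (distr (?Q \<Otimes>\<^sub>M ?R) ?Q (\<lambda>(s, t). resample B s t))
        (prod_emb UNIV (\<lambda>_. \<eta>) J (Pi\<^sub>E J F)) = emeasure (?Q \<Otimes>\<^sub>M ?R) ?E"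
    proof (subst emeasure_distr)
      have "resample B s t \<in> space ?Q" if "s \<in> space ?Q" "t \<in> space ?R" for s t
        using that by (auto simp: space_PiM PiE_iff resample_def)
      then show "emeasure (?Q \<Otimes>\<^sub>M ?R) ((\<lambda>(s, t). resample B s t) -`
          prod_emb UNIV (\<lambda>_. \<eta>) J (Pi\<^sub>E J F) \<inter> space (?Q \<Otimes>\<^sub>M ?R)) = emeasure (?Q \<Otimes>\<^sub>M ?R) ?E"
        by (intro arg_cong[where f = "emeasure (?Q \<Otimes>\<^sub>M ?R)"])
          (auto simp: prod_emb_def space_pair_measure PiE_iff space_PiM)
    qed (use J F in auto)
    also have "\<dots> = (\<integral>\<^sup>+s. emeasure ?R (Pair s -` ?E) \<partial>?Q)"
      using E by (rule R.P.emeasure_pair_measure_alt)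
    also have "\<dots> = (\<integral>\<^sup>+s. (\<Prod>i\<in>J. g i (s i)) \<partial>?Q)"
    proof (rule nn_integral_cong)
      fix s assume "s \<in> space ?Q"
      then have "Pair s -` ?E = {t \<in> space ?R. \<forall>i\<in>J. resample B s t i \<in> F i}"
        by (auto simp: space_pair_measure)
      then show "emeasure ?R (Pair s -` ?E) = (\<Prod>i\<in>J. g i (s i))"
        using inner by simp
    qed
    also have "\<dots> = (\<Prod>i\<in>J. \<integral>\<^sup>+s. g i (s i) \<partial>?Q)"
    proof (rule Q.P.indep_vars_nn_integral[OF J(1)])
      show "Q.P.indep_vars (\<lambda>_. borel) (\<lambda>i s. g i (s i)) J"
        by (rule Q.P.indep_vars_compose2[OF Q.P.indep_vars_subset[OF indep]]) auto
    qed simp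
    also have "\<dots> = (\<Prod>i\<in>J. emeasure \<eta> (F i))"
    proof (rule prod.cong[OF refl])
      fix i assume i: "i \<in> J"
      have "(\<integral>\<^sup>+s. g i (s i) \<partial>?Q) = (\<integral>\<^sup>+x. g i x \<partial>distr ?Q \<eta> (\<lambda>s. s i))"
        using i by (subst nn_integral_distr) auto
      then show "(\<integral>\<^sup>+s. g i (s i) \<partial>?Q) = emeasure \<eta> (F i)"
        using i by (simp add: Q.PiM_component single)
    qed
    finally show "emeasure (distr (?Q \<Otimes>\<^sub>M ?R) ?Q (\<lambda>(s, t). resample B s t))
        (prod_emb UNIV (\<lambda>_. \<eta>) J (Pi\<^sub>E J F)) = (\<Prod>i\<in>J. emeasure \<eta> (F i))" .
  qed simp
qed

text \<open>
  For a deterministic \<open>n\<close>, the visit count and the sequence of visits are independent, and the visits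
  are i.i.d. with the conditional law on \<open>B\<close>. Indeed \<open>s\<close> has the law of the resampled sequence of
  independent \<open>s\<close> and \<open>t\<close>, for which the two objects are a function of \<open>s\<close> and \<open>t\<close> itself.
\<close>

lemma emeasure_visit_count_visits:
  assumes "prob_space \<eta>" and [measurable]: "B \<in> sets \<eta>" and pos: "emeasure \<eta> B \<noteq> 0"
    and E: "E \<in> sets (\<Pi>\<^sub>M i\<in>(UNIV::nat set). uniform_measure \<eta> B)"
  shows "emeasure (\<Pi>\<^sub>M i\<in>UNIV. \<eta>) {s \<in> space (\<Pi>\<^sub>M i\<in>UNIV. \<eta>). visit_count B n s \<in> A \<and> visits B s \<in> E} =
    emeasure (\<Pi>\<^sub>M i\<in>UNIV. \<eta>) {s \<in> space (\<Pi>\<^sub>M i\<in>UNIV. \<eta>). visit_count B n s \<in> A} *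
    emeasure (\<Pi>\<^sub>M i\<in>UNIV. uniform_measure \<eta> B) E"
proof -
  interpret eta: prob_space \<eta> by fact
  interpret etaB: prob_space "uniform_measure \<eta> B"
    by (rule prob_space_uniform_measure[OF pos]) simp
  let ?Q = "\<Pi>\<^sub>M i\<in>(UNIV::nat set). \<eta>" and ?R = "\<Pi>\<^sub>M i\<in>(UNIV::nat set). uniform_measure \<eta> B"
  interpret Q: prob_space ?Q
    by (rule prob_space_PiM) (rule assms(1))
  interpret R: prob_space ?R
    by (rule prob_space_PiM) (rule etaB.prob_space_axioms)
  interpret QR: pair_sigma_finite ?Q ?R ..
  have sets_R [measurable_cong]: "sets ?R = sets ?Q"
    by (intro sets_PiM_cong) auto
  have [measurable]: "E \<in> sets ?Q"
    using E by (simp add: sets_R)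
  have [measurable]: "(\<lambda>(s, t). resample B s t) \<in> ?Q \<Otimes>\<^sub>M ?R \<rightarrow>\<^sub>M ?Q"
    by measurable
  let ?G = "{s \<in> space ?Q. visit_count B n s \<in> A \<and> visits B s \<in> E}"
    and ?H = "{s \<in> space ?Q. visit_count B n s \<in> A}"
  have G [measurable]: "?G \<in> sets ?Q" by measurable
  have H [measurable]: "?H \<in> sets ?Q" by measurable
  have t_in_B: "AE t in ?R. \<forall>j. t j \<in> B"
    unfolding AE_all_countable
  proof
    fix j :: nat
    show "AE t in ?R. t j \<in> B"
      by (rule AE_PiM_component[where P = "\<lambda>x. x \<in> B"])
        (auto intro: etaB.prob_space_axioms AE_uniform_measureI)
  qed
  have in_B: "AE x in ?Q \<Otimes>\<^sub>M ?R. \<forall>j. snd x j \<in> B"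
    by (rule QR.AE_pair_measure) (measurable, use t_in_B in simp)
  have inf: "AE x in ?Q \<Otimes>\<^sub>M ?R. infinite {i. fst x i \<in> B}"
    unfolding infinite_nat_iff_unbounded_le
    by (rule QR.AE_pair_measure)
      (measurable, use AE_infinite_visits[OF assms(1-3)] in \<open>simp add: infinite_nat_iff_unbounded_le\<close>)
  have "emeasure ?Q ?G = emeasure (distr (?Q \<Otimes>\<^sub>M ?R) ?Q (\<lambda>(s, t). resample B s t)) ?G"
    by (simp add: distr_resample assms)
  also have "\<dots> = emeasure (?Q \<Otimes>\<^sub>M ?R) ((\<lambda>(s, t). resample B s t) -` ?G \<inter> space (?Q \<Otimes>\<^sub>M ?R))"
    by (rule emeasure_distr) measurable
  also have "\<dots> = emeasure (?Q \<Otimes>\<^sub>M ?R) (?H \<times> E)"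
  proof (rule emeasure_eq_AE)
    show "AE x in ?Q \<Otimes>\<^sub>M ?R. x \<in> (\<lambda>(s, t). resample B s t) -` ?G \<inter> space (?Q \<Otimes>\<^sub>M ?R) \<longleftrightarrow>
        x \<in> ?H \<times> E"
      using in_B inf AE_space
    proof eventually_elim
      case (elim x)
      moreover have "case_prod (resample B) x \<in> space ?Q"
        using elim(3) by (auto simp: resample_def space_pair_measure space_PiM PiE_iff)
      ultimately show ?case
        by (cases x) (auto simp: visit_count_resample visits_resample space_pair_measure)
    qed
  qed (use E in measurable)
  also have "\<dots> = emeasure ?Q ?H * emeasure ?R E"
    by (rule R.emeasure_pair_measure_Times[OF H E])
  finally show ?thesis .
qed

text \<open>
  The same for a random time \<open>N\<close> that is independent of the sequence. Independence of \<open>N\<close> and \<open>X\<close>,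
  as well as the conclusion, is expressed by a product form of the joint law.
\<close>

lemma (in prob_space) distr_visit_count_visits:
  fixes N :: "'a \<Rightarrow> enat" and X :: "'a \<Rightarrow> nat \<Rightarrow> 'b"
  assumes "prob_space \<eta>" and [measurable]: "B \<in> sets \<eta>" and pos: "emeasure \<eta> B \<noteq> 0"
    and N [measurable]: "N \<in> measurable M (count_space UNIV)"
    and X [measurable]: "X \<in> measurable M (\<Pi>\<^sub>M i\<in>(UNIV::nat set). \<eta>)"
    and law: "distr M (count_space UNIV) N \<Otimes>\<^sub>M (\<Pi>\<^sub>M i\<in>UNIV. \<eta>) =
      distr M (count_space UNIV \<Otimes>\<^sub>M (\<Pi>\<^sub>M i\<in>UNIV. \<eta>)) (\<lambda>\<omega>. (N \<omega>, X \<omega>))"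
  shows "distr M (count_space UNIV) (\<lambda>\<omega>. visit_count B (N \<omega>) (X \<omega>)) \<Otimes>\<^sub>M
      (\<Pi>\<^sub>M i\<in>UNIV. uniform_measure \<eta> B) =
    distr M (count_space UNIV \<Otimes>\<^sub>M (\<Pi>\<^sub>M i\<in>UNIV. uniform_measure \<eta> B))
      (\<lambda>\<omega>. (visit_count B (N \<omega>) (X \<omega>), visits B (X \<omega>)))"
proof -
  interpret eta: prob_space \<eta> by fact
  interpret etaB: prob_space "uniform_measure \<eta> B"
    by (rule prob_space_uniform_measure[OF pos]) simp
  let ?Q = "\<Pi>\<^sub>M i\<in>(UNIV::nat set). \<eta>" and ?R = "\<Pi>\<^sub>M i\<in>(UNIV::nat set). uniform_measure \<eta> B"
  let ?C = "count_space UNIV :: enat measure" and ?\<mu> = "distr M (count_space UNIV) N"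
  let ?K = "\<lambda>\<omega>. visit_count B (N \<omega>) (X \<omega>)" and ?V = "\<lambda>\<omega>. visits B (X \<omega>)"
  interpret Q: prob_space ?Q
    by (rule prob_space_PiM) (rule assms(1))
  interpret R: prob_space ?R
    by (rule prob_space_PiM) (rule etaB.prob_space_axioms)
  interpret D: prob_space "distr M ?C ?K"
    by (rule prob_space_distr) measurable
  have sets_R [measurable_cong]: "sets ?R = sets ?Q"
    by (intro sets_PiM_cong) auto
  \<comment> \<open>Fubini: condition on the value of \<open>N\<close>.\<close>
  have joint: "emeasure M {\<omega> \<in> space M. ?K \<omega> \<in> A \<and> ?V \<omega> \<in> E} =
      (\<integral>\<^sup>+n. emeasure ?Q {s \<in> space ?Q. visit_count B n s \<in> A \<and> visits B s \<in> E} \<partial>?\<mu>)"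
    if E [measurable]: "E \<in> sets ?Q" for A E
  proof -
    let ?G = "{x \<in> space (?C \<Otimes>\<^sub>M ?Q). visit_count B (fst x) (snd x) \<in> A \<and> visits B (snd x) \<in> E}"
    have G: "?G \<in> sets (?\<mu> \<Otimes>\<^sub>M ?Q)"
      by measurable
    have "{\<omega> \<in> space M. ?K \<omega> \<in> A \<and> ?V \<omega> \<in> E} = (\<lambda>\<omega>. (N \<omega>, X \<omega>)) -` ?G \<inter> space M"
      using measurable_space[OF X] by (auto simp: space_pair_measure)
    also have "emeasure M \<dots> = emeasure (distr M (?C \<Otimes>\<^sub>M ?Q) (\<lambda>\<omega>. (N \<omega>, X \<omega>))) ?G"
      by (rule emeasure_distr[symmetric]) measurable
    also have "\<dots> = emeasure (?\<mu> \<Otimes>\<^sub>M ?Q) ?G"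
      by (simp add: law)
    also have "\<dots> = (\<integral>\<^sup>+n. emeasure ?Q (Pair n -` ?G) \<partial>?\<mu>)"
      by (rule Q.emeasure_pair_measure_alt[OF G])
    also have "\<dots> = (\<integral>\<^sup>+n. emeasure ?Q {s \<in> space ?Q. visit_count B n s \<in> A \<and> visits B s \<in> E} \<partial>?\<mu>)"
      by (intro nn_integral_cong arg_cong[where f = "emeasure ?Q"]) (auto simp: space_pair_measure)
    finally show ?thesis .
  qed
  have V_space: "?V \<omega> \<in> space ?Q" if "\<omega> \<in> space M" for \<omega>
    using measurable_space[OF measurable_visits[OF assms(2) X] that] .
  have vQ: "visits B s \<in> space ?Q" if "s \<in> space ?Q" for s
    using that by (auto simp: visits_def space_PiM PiE_iff)
  show ?thesis
  proof (rule pair_measure_eqI)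
    fix A E assume A: "A \<in> sets (distr M ?C ?K)" and E': "E \<in> sets ?R"
    then have E [measurable]: "E \<in> sets ?Q" by (simp add: sets_R)
    have meas [measurable]: "(\<lambda>n. emeasure ?Q {s \<in> space ?Q. visit_count B n s \<in> A}) \<in> borel_measurable ?\<mu>"
      by (simp cong: measurable_cong_sets)
    have "emeasure (distr M (?C \<Otimes>\<^sub>M ?R) (\<lambda>\<omega>. (?K \<omega>, ?V \<omega>))) (A \<times> E) =
        emeasure M ((\<lambda>\<omega>. (?K \<omega>, ?V \<omega>)) -` (A \<times> E) \<inter> space M)"
      using A E' by (intro emeasure_distr) auto
    also have "(\<lambda>\<omega>. (?K \<omega>, ?V \<omega>)) -` (A \<times> E) \<inter> space M = {\<omega> \<in> space M. ?K \<omega> \<in> A \<and> ?V \<omega> \<in> E}"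
      by auto
    also have "emeasure M \<dots> = (\<integral>\<^sup>+n. emeasure ?Q {s \<in> space ?Q. visit_count B n s \<in> A} * emeasure ?R E \<partial>?\<mu>)"
      unfolding joint[OF E] emeasure_visit_count_visits[OF assms(1-3) E'] ..
    also have "\<dots> = (\<integral>\<^sup>+n. emeasure ?Q {s \<in> space ?Q. visit_count B n s \<in> A} \<partial>?\<mu>) * emeasure ?R E"
      by (rule nn_integral_multc) measurable
    also have "(\<integral>\<^sup>+n. emeasure ?Q {s \<in> space ?Q. visit_count B n s \<in> A} \<partial>?\<mu>) =
        emeasure M {\<omega> \<in> space M. ?K \<omega> \<in> A}"
      using joint[OF sets.top, of A] vQ V_space by (simp cong: conj_cong)
    also have "\<dots> = emeasure (distr M ?C ?K) A"
      using A by (subst emeasure_distr) (auto intro!: arg_cong[where f="emeasure M"])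
    finally show "emeasure (distr M ?C ?K) A * emeasure ?R E =
        emeasure (distr M (?C \<Otimes>\<^sub>M ?R) (\<lambda>\<omega>. (?K \<omega>, ?V \<omega>))) (A \<times> E)"
      by simp
  next
    show "sets (distr M ?C ?K \<Otimes>\<^sub>M ?R) = sets (distr M (?C \<Otimes>\<^sub>M ?R) (\<lambda>\<omega>. (?K \<omega>, ?V \<omega>)))"
      unfolding sets_distr by (rule sets_pair_measure_cong) simp_all
  qed (rule D.sigma_finite_measure_axioms R.sigma_finite_measure_axioms)+
qed

section \<open>Conditional law of the marks at the visit times\<close>

text \<open>
  The indicator of \<open>D\<close> is measurable for the conditioning \<open>\<sigma>\<close>-algebra, so it can be pulled out of
  both conditional expectations.
\<close>

lemma (in sigma_finite_subalgebra) real_cond_exp_local: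
  assumes D: "D \<in> sets F" and f: "integrable M f" and g: "integrable M g"
    and eq: "\<And>x. x \<in> D \<Longrightarrow> f x = g x"
  shows "AE x in M. x \<in> D \<longrightarrow> real_cond_exp M F f x = real_cond_exp M F g x"
proof -
  have [measurable]: "D \<in> sets M" "D \<in> sets F"
    using D subalg by (auto simp: subalgebra_def)
  note [measurable] = borel_measurable_integrable[OF f] borel_measurable_integrable[OF g]
  have fg: "(\<lambda>x. indicator D x * f x) = (\<lambda>x. indicator D x * g x :: real)"
    using eq by (auto simp: fun_eq_iff split: split_indicator)
  have "AE x in M. real_cond_exp M F (\<lambda>x. indicator D x * f x) x = indicator D x * real_cond_exp M F f x"
    using integrable_mult_indicator[OF \<open>D \<in> sets M\<close> f]
    by (intro real_cond_exp_mult) simp_all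
  moreover have "AE x in M. real_cond_exp M F (\<lambda>x. indicator D x * g x) x = indicator D x * real_cond_exp M F g x"
    using integrable_mult_indicator[OF \<open>D \<in> sets M\<close> g]
    by (intro real_cond_exp_mult) simp_all
  ultimately show ?thesis
    unfolding fg by eventually_elim auto
qed

lemma measurable_compose_countable2:
  fixes f :: "'i::countable \<Rightarrow> 'j::countable \<Rightarrow> 'a \<Rightarrow> 'b"
  assumes f: "\<And>i j. f i j \<in> measurable M N"
    and g: "g \<in> measurable M (count_space UNIV)" and h: "h \<in> measurable M (count_space UNIV)"
  shows "(\<lambda>x. f (g x) (h x) x) \<in> measurable M N"
  by (rule measurable_compose_countable[OF measurable_compose_countable[OF f h] g])

text \<open>
  Conditionally on \<open>N\<close> and the whole sequence, the visit times are known. On the event that they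
  have given values \<open>t\<close>, the marks at the visit times are marks at the fixed indices \<open>t\<close>, whose
  conditional law is the hypothesis; by locality it may be evaluated there. The resulting product
  depends only on the positions of the visits, so by the tower property it is also the conditional
  probability given the coarser information of the visits and their number.
\<close>

lemma (in prob_space) cond_prob_given_visits:
  fixes N :: "'a \<Rightarrow> enat" and S :: "nat \<Rightarrow> 'a \<Rightarrow> 'b::polish_space"
    and A :: "nat \<Rightarrow> nat \<Rightarrow> 'a \<Rightarrow> bool"
  defines "X \<equiv> \<lambda>\<omega> i. S i \<omega>"
  defines "K \<equiv> count_space UNIV \<Otimes>\<^sub>M (\<Pi>\<^sub>M i\<in>(UNIV::nat set). (borel :: 'b measure))"
  assumes B [measurable]: "B \<in> sets borel" and W: "connection_kernel W"
    and N [measurable]: "N \<in> measurable M (count_space UNIV)"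
    and S [measurable]: "\<And>i. S i \<in> borel_measurable M"
    and A [measurable]: "\<And>i j. A i j \<in> measurable M (count_space UNIV)"
    and inf: "AE \<omega> in M. infinite {i. S i \<omega> \<in> B}"
    and cond: "\<And>F (b :: nat \<times> nat \<Rightarrow> bool). finite F \<Longrightarrow> F \<subseteq> {(i, j). i < j} \<Longrightarrow>
      (AE \<omega> in M. cond_prob_given M K (\<lambda>\<omega>'. (N \<omega>', X \<omega>'))
          {\<omega>'\<in>space M. \<forall>(i, j)\<in>F. A i j \<omega>' = b (i, j)} \<omega> =
        (\<Prod>(i, j)\<in>F. if b (i, j) then W (S i \<omega>, S j \<omega>) else 1 - W (S i \<omega>, S j \<omega>)))"
    and F: "finite F" "F \<subseteq> {(i, j). i < j}"
  shows "AE \<omega> in M. cond_prob_given M K (\<lambda>\<omega>'. (visit_count B (N \<omega>') (X \<omega>'), visits B (X \<omega>')))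
      {\<omega>'\<in>space M. \<forall>(i, j)\<in>F. A (visit_time B (X \<omega>') i) (visit_time B (X \<omega>') j) \<omega>' = b (i, j)} \<omega> =
    (\<Prod>(i, j)\<in>F. if b (i, j) then W (visits B (X \<omega>) i, visits B (X \<omega>) j)
      else 1 - W (visits B (X \<omega>) i, visits B (X \<omega>) j))"
proof -
  define \<F> where "\<F> = vimage_algebra (space M) (\<lambda>\<omega>. (N \<omega>, X \<omega>)) K"
  define \<G> where "\<G> = vimage_algebra (space M) (\<lambda>\<omega>. (visit_count B (N \<omega>) (X \<omega>), visits B (X \<omega>))) K"
  have X [measurable]: "X \<in> M \<rightarrow>\<^sub>M (\<Pi>\<^sub>M i\<in>UNIV. borel)"
    unfolding X_def by (rule measurable_PiM_single') simp_all
  have space_K: "space K = UNIV"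
    by (auto simp: K_def space_pair_measure space_PiM)
  have [simp]: "space \<F> = space M" "space \<G> = space M"
    by (simp_all add: \<F>_def \<G>_def)
  have NX: "(\<lambda>\<omega>. (N \<omega>, X \<omega>)) \<in> \<F> \<rightarrow>\<^sub>M K"
    unfolding \<F>_def by (rule measurable_vimage_algebra1) (simp add: space_K)
  have X_F [measurable]: "X \<in> \<F> \<rightarrow>\<^sub>M (\<Pi>\<^sub>M i\<in>UNIV. borel)" and N_F [measurable]: "N \<in> \<F> \<rightarrow>\<^sub>M count_space UNIV"
    using measurable_compose[OF NX[unfolded K_def] measurable_snd]
      measurable_compose[OF NX[unfolded K_def] measurable_fst] by simp_all
  have "sets (vimage_algebra (space M) (\<lambda>\<omega>. (N \<omega>, X \<omega>)) K) \<subseteq> sets M"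
    by (rule sets_image_in_sets) (simp_all add: K_def)
  then have sub_F: "subalgebra M \<F>"
    by (simp add: subalgebra_def \<F>_def)
  have "sets (vimage_algebra (space \<F>) (\<lambda>\<omega>. (visit_count B (N \<omega>) (X \<omega>), visits B (X \<omega>))) K) \<subseteq> sets \<F>"
    by (rule sets_image_in_sets) (simp_all add: K_def)
  then have sub_GF: "subalgebra \<F> \<G>"
    by (simp add: subalgebra_def \<G>_def)
  have sub_G: "subalgebra M \<G>"
    using sub_F sub_GF by (auto simp: subalgebra_def)
  interpret F: finite_measure_subalgebra M \<F>
    by unfold_locales (rule sub_F)
  interpret G: finite_measure_subalgebra M \<G>
    by unfold_locales (rule sub_G)
  define E where "E = {\<omega>\<in>space M. \<forall>(i, j)\<in>F. A (visit_time B (X \<omega>) i) (visit_time B (X \<omega>) j) \<omega> = b (i, j)}"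
  define h where "h s = (\<Prod>(i, j)\<in>F. if b (i, j) then W (s i, s j) else 1 - W (s i, s j))" for s
  have A_visit [measurable]: "Measurable.pred M (\<lambda>\<omega>. A (visit_time B (X \<omega>) i) (visit_time B (X \<omega>) j) \<omega>)" for i j
    by (rule measurable_compose_countable2[where f = A]) measurable
  have E: "E \<in> sets M"
    unfolding E_def split_beta using F(1) by measurable
  have W_meas [measurable]: "W \<in> borel_measurable borel" and W01: "0 \<le> W p" "W p \<le> 1" for p
    using W by (cases p; simp add: connection_kernel_def)+
  have h_meas: "h \<in> borel_measurable (\<Pi>\<^sub>M i\<in>UNIV. borel)"
    unfolding h_def split_beta by measurable
  have h_bound: "norm (h s) \<le> 1" for s
  proof -
    have "0 \<le> h s" "h s \<le> 1"
      unfolding h_def by (auto intro!: prod_nonneg prod_le_1 simp: W01)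
    then show ?thesis by simp
  qed
  \<comment> \<open>Only the first \<open>m\<close> visit times matter for \<open>F\<close>, so there are countably many cases.\<close>
  obtain m where m: "\<And>i j. (i, j) \<in> F \<Longrightarrow> i < m \<and> j < m"
  proof -
    have "finite (fst ` F \<union> snd ` F)"
      using F by simp
    then obtain m where "\<forall>i\<in>fst ` F \<union> snd ` F. i < m"
      by (meson finite_nat_set_iff_bounded)
    then show ?thesis
      by (intro that[of m]) force
  qed
  have times: "AE \<omega> in M. map (visit_time B (X \<omega>)) [0..<m] = t \<longrightarrow>
      infinite {i. S i \<omega> \<in> B} \<longrightarrow> real_cond_exp M \<F> (indicator E) \<omega> = h (visits B (X \<omega>))" for t
  proof (cases "length t = m \<and> (\<forall>i j. i < j \<longrightarrow> j < m \<longrightarrow> t ! i < t ! j)")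
    case True
    define D where "D = {\<omega> \<in> space M. map (visit_time B (X \<omega>)) [0..<m] = t}"
    define \<phi> where "\<phi> = (\<lambda>(i, j). (t ! i, t ! j))"
    have t_inj: "t ! i = t ! j \<longleftrightarrow> i = j" if "i < m" "j < m" for i j
      using True that by (metis less_irrefl linorder_neqE_nat)
    have inj: "inj_on \<phi> F"
      by (rule inj_onI) (use m in \<open>auto simp: \<phi>_def t_inj\<close>)
    have F': "finite (\<phi> ` F)" "\<phi> ` F \<subseteq> {(i, j). i < j}"
      using F True m by (auto simp: \<phi>_def)
    \<comment> \<open>The prescribed marks \<open>b\<close>, carried over to the pairs of indices \<open>(t ! i, t ! j)\<close>.\<close>
    define b' where "b' = b \<circ> the_inv_into F \<phi>"
    have b': "b' (\<phi> p) = b p" if "p \<in> F" for p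
      using the_inv_into_f_f[OF inj that] by (simp add: b'_def)
    define E' where "E' = {\<omega>\<in>space M. \<forall>(i, j)\<in>\<phi> ` F. A i j \<omega> = b' (i, j)}"
    have E'_eq: "E' = {\<omega>\<in>space M. \<forall>(i, j)\<in>F. A (t ! i) (t ! j) \<omega> = b (i, j)}"
      unfolding E'_def using b' by (auto simp: \<phi>_def split: prod.splits)
    have E' [measurable]: "E' \<in> sets M"
      unfolding E'_eq split_beta using F(1) by measurable
    have D_eq: "D = {\<omega> \<in> space \<F>. \<forall>i\<in>{..<m}. visit_time B (X \<omega>) i = t ! i}"
      using True by (auto simp: D_def list_eq_iff_nth_eq)
    have D: "D \<in> sets \<F>"
      unfolding D_eq by measurable
    have time: "visit_time B (X \<omega>) i = t ! i" if "\<omega> \<in> D" "i < m" for \<omega> i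
      using that by (simp add: D_eq)
    have "AE \<omega> in M. \<omega> \<in> D \<longrightarrow> real_cond_exp M \<F> (indicator E) \<omega> = real_cond_exp M \<F> (indicator E') \<omega>"
    proof (rule F.real_cond_exp_local[OF D])
      fix \<omega> assume \<omega>: "\<omega> \<in> D"
      then have "\<omega> \<in> E \<longleftrightarrow> \<omega> \<in> E'"
        using m time[OF \<omega>] by (auto simp: E_def E'_eq D_def)
      then show "indicator E \<omega> = (indicator E' \<omega> :: real)"
        by (simp add: indicator_def)
    qed (use E E' in \<open>auto simp: integrable_indicator_iff emeasure_eq_measure\<close>)
    moreover have "AE \<omega> in M. real_cond_exp M \<F> (indicator E') \<omega> =
        (\<Prod>(i, j)\<in>\<phi> ` F. if b' (i, j) then W (S i \<omega>, S j \<omega>) else 1 - W (S i \<omega>, S j \<omega>))"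
      using cond[OF F', of b'] unfolding cond_prob_given_def \<F>_def E'_def .
    moreover have prod_eq: "(\<Prod>(i, j)\<in>\<phi> ` F. if b' (i, j) then W (S i \<omega>, S j \<omega>) else 1 - W (S i \<omega>, S j \<omega>)) =
        h (visits B (X \<omega>))" if "\<omega> \<in> D" for \<omega>
      unfolding prod.reindex[OF inj] h_def
      by (rule prod.cong[OF refl]) (use m b' time[OF that] in \<open>auto simp: \<phi>_def visits_def X_def\<close>)
    ultimately have "AE \<omega> in M. \<omega> \<in> D \<longrightarrow> real_cond_exp M \<F> (indicator E) \<omega> = h (visits B (X \<omega>))"
    proof eventually_elim
      case (elim \<omega>)
      then show ?case using prod_eq[of \<omega>] by metis
    qed
    with AE_space show ?thesis
      by eventually_elim (simp add: D_def)
  next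
    case False
    \<comment> \<open>Visit times are strictly increasing, so \<open>t\<close> is not attained.\<close>
    have "\<not> (map (visit_time B (X \<omega>)) [0..<m] = t \<and> infinite {i. S i \<omega> \<in> B})" for \<omega>
    proof
      assume *: "map (visit_time B (X \<omega>)) [0..<m] = t \<and> infinite {i. S i \<omega> \<in> B}"
      then have "strict_mono (visit_time B (X \<omega>))"
        by (intro strict_mono_visit_time) (simp add: X_def)
      with * False show False
        by (auto simp: strict_mono_def)
    qed
    then show ?thesis by auto
  qed
  have "AE \<omega> in M. \<forall>t. map (visit_time B (X \<omega>)) [0..<m] = t \<longrightarrow>
      infinite {i. S i \<omega> \<in> B} \<longrightarrow> real_cond_exp M \<F> (indicator E) \<omega> = h (visits B (X \<omega>))"
    unfolding AE_all_countable using times by blast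
  with inf have cond_F: "AE \<omega> in M. real_cond_exp M \<F> (indicator E) \<omega> = h (visits B (X \<omega>))"
    by eventually_elim blast
  have visits_G: "(\<lambda>\<omega>. (visit_count B (N \<omega>) (X \<omega>), visits B (X \<omega>))) \<in> \<G> \<rightarrow>\<^sub>M K"
    unfolding \<G>_def by (rule measurable_vimage_algebra1) (simp add: space_K)
  have h_G: "(\<lambda>\<omega>. h (visits B (X \<omega>))) \<in> borel_measurable \<G>"
    using measurable_compose[OF measurable_compose[OF visits_G[unfolded K_def] measurable_snd] h_meas] by simp
  then have h_M: "(\<lambda>\<omega>. h (visits B (X \<omega>))) \<in> borel_measurable M"
    by (rule measurable_from_subalg[OF sub_G])
  have "AE \<omega> in M. real_cond_exp M \<G> (real_cond_exp M \<F> (indicator E)) \<omega> = real_cond_exp M \<G> (indicator E) \<omega>"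
    using E by (intro G.real_cond_exp_nested_subalg sub_F sub_GF)
      (auto simp: integrable_indicator_iff emeasure_eq_measure)
  moreover have "AE \<omega> in M. real_cond_exp M \<G> (real_cond_exp M \<F> (indicator E)) \<omega> =
      real_cond_exp M \<G> (\<lambda>\<omega>. h (visits B (X \<omega>))) \<omega>"
    by (rule G.real_cond_exp_cong[OF cond_F _ h_M]) simp
  moreover have "AE \<omega> in M. real_cond_exp M \<G> (\<lambda>\<omega>. h (visits B (X \<omega>))) \<omega> = h (visits B (X \<omega>))"
    using h_M h_bound h_G by (intro G.real_cond_exp_F_meas integrable_const_bound[where B = 1]) auto
  ultimately have "AE \<omega> in M. real_cond_exp M \<G> (indicator E) \<omega> = h (visits B (X \<omega>))"
    by eventually_elim simp
  then show ?thesis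
    unfolding cond_prob_given_def \<G>_def[symmetric] E_def[symmetric] h_def .
qed

section \<open>Inverse transform sampling on a subset\<close>

lemma prob_space_unit_lebesgue: "prob_space unit_lebesgue"
  by (rule prob_spaceI) (simp add: unit_lebesgue_def space_restrict_space emeasure_restrict_space)

lemma space_unit_lebesgue [simp]: "space unit_lebesgue = {0..1}"
  by (simp add: unit_lebesgue_def space_restrict_space)

lemma sets_unit_lebesgue [simp, measurable_cong]:
  "sets unit_lebesgue = sets (restrict_space borel {0..1})"
  by (simp add: unit_lebesgue_def sets_restrict_space)

lemma emeasure_unit_lebesgue:
  "A \<subseteq> {0..1} \<Longrightarrow> emeasure unit_lebesgue A = emeasure lborel A"
  by (simp add: unit_lebesgue_def emeasure_restrict_space)

text \<open>
  Inverse transform sampling. \<open>T_map f B\<close> is the generalised inverse of the distribution function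
  of the uniform law on \<open>X\<close>: the requirement \<open>y \<in> {0..1}\<close> in its definition does not change the
  infimum for arguments in the open interval, because that law lives on \<open>{0..1}\<close>. Hence the map
  transports Lebesgue measure to this law.
\<close>

lemma
  fixes f :: "real \<Rightarrow> 'a" and B :: "'a set"
  defines "X \<equiv> {u \<in> {0..1}. f u \<in> B}"
  assumes X [measurable]: "X \<in> sets borel" and pos: "emeasure lborel X \<noteq> 0"
  shows measurable_T_map: "T_map f B \<in> unit_lebesgue \<rightarrow>\<^sub>M unit_lebesgue"
    and distr_T_map: "distr unit_lebesgue unit_lebesgue (T_map f B) = uniform_measure unit_lebesgue X"
proof -
  define Q where "Q = uniform_measure lborel X"
  have X01: "X \<subseteq> {0..1}"
    by (auto simp: X_def)
  have "emeasure lborel X \<le> emeasure lborel {0..1::real}"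
    by (rule emeasure_mono[OF X01]) simp
  then have fin: "emeasure lborel X \<noteq> \<infinity>"
    by (auto simp: top_unique)
  interpret Q: prob_space Q
    unfolding Q_def by (rule prob_space_uniform_measure[OF pos fin])
  interpret Q: cdf_distribution Q
    by unfold_locales (simp add: Q_def)
  have cdf: "cdf Q y = measure lborel (X \<inter> {..y}) / measure lborel X" for y
    unfolding cdf_def Q_def by (rule measure_uniform_measure[OF pos fin]) simp
  have cdf01: "cdf Q y = measure lborel (X \<inter> {0..y}) / measure lborel X" if "0 \<le> y" for y
  proof -
    have "X \<inter> {..y} = X \<inter> {0..y}"
      using X01 by auto
    then show ?thesis by (simp add: cdf)
  qed
  have cdf_neg: "cdf Q y = 0" if "y < 0" for y
  proof -
    have "X \<inter> {..y} = {}"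
      using X01 that by auto
    then show ?thesis by (simp add: cdf)
  qed
  have cdf_1: "cdf Q 1 = 1"
  proof -
    have "X \<inter> {..1} = X"
      using X01 by auto
    then show ?thesis
      using pos fin by (simp add: cdf measure_def enn2real_eq_0_iff)
  qed
  have T: "T_map f B x = Inf {y \<in> {0..1}. x \<le> cdf Q y}" for x
    unfolding T_map_def X_def[symmetric] by (rule arg_cong[where f = Inf]) (auto simp: cdf01)
  have bdd: "bdd_below {y \<in> {0..1}. x \<le> cdf Q y}" for x
    by (rule bdd_belowI[of _ 0]) auto
  have T01: "T_map f B x \<in> {0..1}" if "x \<le> 1" for x
  proof -
    have *: "1 \<in> {y \<in> {0..1}. x \<le> cdf Q y}"
      using that cdf_1 by simp
    have "Inf {y \<in> {0..1}. x \<le> cdf Q y} \<le> 1"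
      by (rule cInf_lower[OF * bdd])
    moreover have "0 \<le> Inf {y \<in> {0..1}. x \<le> cdf Q y}"
      using * by (intro cInf_greatest) auto
    ultimately show ?thesis
      unfolding T by simp
  qed
  have "mono_on {0..1} (T_map f B)"
    unfolding T using cdf_1
    by (intro mono_onI cInf_superset_mono bdd) (auto dest: spec[of _ 1])
  then have T_borel [measurable]: "T_map f B \<in> borel_measurable (restrict_space borel {0..1})"
    by (rule borel_measurable_mono_on_fnc)
  then have "T_map f B \<in> restrict_space borel {0..1} \<rightarrow>\<^sub>M restrict_space borel {0..1}"
    by (rule measurable_restrict_space2[rotated]) (auto intro: T01 simp: space_restrict_space)
  then show meas: "T_map f B \<in> unit_lebesgue \<rightarrow>\<^sub>M unit_lebesgue"
    by (simp cong: measurable_cong_sets)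
  \<comment> \<open>At \<open>x = 0\<close> every \<open>y\<close> satisfies the inequality, and the two infima differ.\<close>
  have T_I: "T_map f B x = Q.I x" if "0 < x" "x < 1" for x
  proof (rule antisym)
    have nonneg: "0 \<le> y" if "x \<le> cdf Q y" for y
      using that \<open>0 < x\<close> cdf_neg[of y] by linarith
    show "T_map f B x \<le> Q.I x"
    proof (rule cInf_greatest)
      show "{y. x \<le> cdf Q y} \<noteq> {}"
        using \<open>x < 1\<close> cdf_1 by (auto intro!: exI[of _ 1])
      fix y assume "y \<in> {y. x \<le> cdf Q y}"
      then have y: "x \<le> cdf Q y" by simp
      have "T_map f B x \<le> min y 1"
        unfolding T using y nonneg[OF y] \<open>x < 1\<close> cdf_1
        by (intro cInf_lower bdd) (auto simp: min_def)
      then show "T_map f B x \<le> y" by simp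
    qed
    show "Q.I x \<le> T_map f B x"
      unfolding T using nonneg \<open>x < 1\<close> cdf_1
      by (intro cInf_superset_mono bdd_belowI[of _ 0]) (auto dest: spec[of _ 1])
  qed
  show "distr unit_lebesgue unit_lebesgue (T_map f B) = uniform_measure unit_lebesgue X"
  proof (rule measure_eqI)
    fix Y assume "Y \<in> sets (distr unit_lebesgue unit_lebesgue (T_map f B))"
    then have Y: "Y \<in> sets borel" "Y \<subseteq> {0..1}" "Y \<in> sets unit_lebesgue"
      by (auto simp: sets_restrict_space_iff)
    have [measurable]: "Y \<in> sets borel" by (rule Y)
    have TY: "T_map f B -` Y \<inter> {0..1} \<in> sets borel"
      using measurable_sets[OF T_borel Y(1)] by (simp add: space_restrict_space sets_restrict_space_iff)
    have IY: "Q.I -` Y \<inter> {0<..<1} \<in> sets borel"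
      using measurable_sets[OF Q.measurable_CI Y(1)] by (simp add: space_restrict_space sets_restrict_space_iff)
    have "emeasure (distr unit_lebesgue unit_lebesgue (T_map f B)) Y =
        emeasure lborel (T_map f B -` Y \<inter> {0..1})"
      using Y meas by (simp add: emeasure_distr emeasure_unit_lebesgue)
    also have "\<dots> = emeasure lborel (Q.I -` Y \<inter> {0<..<1})"
    proof (rule emeasure_eq_AE)
      show "AE x in lborel. x \<in> T_map f B -` Y \<inter> {0..1} \<longleftrightarrow> x \<in> Q.I -` Y \<inter> {0<..<1}"
        using AE_lborel_singleton[of "0::real"] AE_lborel_singleton[of "1::real"]
        by eventually_elim (use T_I in force)
    qed (use TY IY in simp_all)
    also have "\<dots> = emeasure (distr (restrict_space lborel {0<..<1::real}) borel Q.I) Y"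
    proof (subst emeasure_distr)
      show "Q.I \<in> borel_measurable (restrict_space lborel {0<..<1})"
        using Q.measurable_CI by (simp cong: measurable_cong_sets add: sets_restrict_space)
    qed (simp_all add: space_restrict_space emeasure_restrict_space)
    also have "\<dots> = emeasure lborel (X \<inter> Y) / emeasure lborel X"
      unfolding Q.distr_I_eq_M by (simp add: Q_def)
    also have "\<dots> = emeasure (uniform_measure unit_lebesgue X) Y"
      using X01 Y by (simp add: emeasure_unit_lebesgue[OF X01] emeasure_unit_lebesgue[OF le_infI1[OF X01]]
          sets_restrict_space_iff)
    finally show "emeasure (distr unit_lebesgue unit_lebesgue (T_map f B)) Y =
        emeasure (uniform_measure unit_lebesgue X) Y" .
  qed simp
qed

lemma distr_uniform_measure_vimage:
  assumes [measurable]: "f \<in> M \<rightarrow>\<^sub>M N" "B \<in> sets N"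
  shows "distr (uniform_measure M (f -` B \<inter> space M)) N f = uniform_measure (distr M N f) B"
proof (rule measure_eqI)
  fix A assume "A \<in> sets (distr (uniform_measure M (f -` B \<inter> space M)) N f)"
  then have [measurable]: "A \<in> sets N" by simp
  have "(f -` B \<inter> space M) \<inter> (f -` A \<inter> space M) = f -` (B \<inter> A) \<inter> space M"
    by auto
  then show "emeasure (distr (uniform_measure M (f -` B \<inter> space M)) N f) A =
      emeasure (uniform_measure (distr M N f) B) A"
    by (simp add: emeasure_distr)
qed simp

lemma
  fixes f :: "real \<Rightarrow> 'a::topological_space"
  assumes f [measurable]: "f \<in> borel_measurable unit_lebesgue" and B [measurable]: "B \<in> sets borel"
    and pos: "emeasure (distr unit_lebesgue borel f) B \<noteq> 0"
  shows measurable_comp_T_map: "f \<circ> T_map f B \<in> borel_measurable unit_lebesgue"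
    and distr_comp_T_map:
      "distr unit_lebesgue borel (f \<circ> T_map f B) = uniform_measure (distr unit_lebesgue borel f) B"
proof -
  have X_eq: "{u \<in> {0..1}. f u \<in> B} = f -` B \<inter> space unit_lebesgue"
    by auto
  have "f -` B \<inter> space unit_lebesgue \<in> sets unit_lebesgue"
    by measurable
  then have X: "{u \<in> {0..1}. f u \<in> B} \<in> sets borel"
    unfolding X_eq by (simp add: sets_restrict_space_iff)
  have X_pos: "emeasure lborel {u \<in> {0..1}. f u \<in> B} \<noteq> 0"
    using pos unfolding X_eq by (simp add: emeasure_distr emeasure_unit_lebesgue)
  note T = measurable_T_map[OF X X_pos] distr_T_map[OF X X_pos]
  show "f \<circ> T_map f B \<in> borel_measurable unit_lebesgue"
    using T(1) f by (rule measurable_comp)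
  have "distr unit_lebesgue borel (f \<circ> T_map f B) =
      distr (distr unit_lebesgue unit_lebesgue (T_map f B)) borel f"
    using T(1) f by (simp add: distr_distr)
  also have "\<dots> = uniform_measure (distr unit_lebesgue borel f) B"
    unfolding T(2) X_eq by (rule distr_uniform_measure_vimage) measurable
  finally show "distr unit_lebesgue borel (f \<circ> T_map f B) =
      uniform_measure (distr unit_lebesgue borel f) B" .
qed

section \<open>Restriction of graph representations\<close>

lemma borel_set_square_marks:
  fixes B :: "'a::polish_space set"
  assumes [measurable]: "B \<in> sets borel"
  shows "(B \<times> B) \<times> (UNIV :: bool set) \<in> sets borel"
proof -
  have "(B \<times> B) \<times> (UNIV :: bool set) \<in> sets ((borel \<Otimes>\<^sub>M borel) \<Otimes>\<^sub>M borel)"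
    by (intro pair_measureI) simp_all
  then show ?thesis
    by (simp only: borel_prod)
qed

lemma sets_sum_diracs [simp]: "sets (sum_diracs I x) = sets borel"
  by (simp add: sum_diracs_def)

lemma emeasure_sum_diracs:
  assumes "Y \<in> sets borel"
  shows "emeasure (sum_diracs I x) Y = emeasure (count_space UNIV) {i \<in> I. x i \<in> Y}"
proof -
  have "x -` Y \<inter> I = {i \<in> I. x i \<in> Y}"
    by auto
  with assms show ?thesis
    by (simp add: sum_diracs_def emeasure_distr emeasure_count_space)
qed

lemma sum_diracs_image:
  assumes "inj_on g I"
  shows "sum_diracs (g ` I) x = sum_diracs I (x \<circ> g)"
proof -
  have "distr (count_space I) (count_space (g ` I)) g = count_space (g ` I)"
    using assms by (intro distr_bij_count_space) (simp add: bij_betw_def)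
  then have "sum_diracs (g ` I) x = distr (distr (count_space I) (count_space (g ` I)) g) borel x"
    by (simp add: sum_diracs_def)
  also have "\<dots> = sum_diracs I (x \<circ> g)"
    by (subst distr_distr) (auto simp: sum_diracs_def)
  finally show ?thesis .
qed

lemma restrict_adjacency_sum_diracs:
  assumes "B \<in> sets borel"
  shows "restrict_adjacency B (sum_diracs I x) = sum_diracs {i \<in> I. x i \<in> (B \<times> B) \<times> UNIV} x"
proof (rule measure_eqI)
  fix Y assume "Y \<in> sets (restrict_adjacency B (sum_diracs I x))"
  then have Y: "Y \<in> sets borel"
    by (simp add: restrict_adjacency_def)
  note BB = borel_set_square_marks[OF assms]
  have "emeasure (restrict_adjacency B (sum_diracs I x)) Y =
      emeasure (sum_diracs I x) ((B \<times> B) \<times> UNIV \<inter> Y)"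
    unfolding restrict_adjacency_def using BB Y by (intro emeasure_restricted) simp_all
  also have "\<dots> = emeasure (sum_diracs {i \<in> I. x i \<in> (B \<times> B) \<times> UNIV} x) Y"
    using BB Y by (simp add: emeasure_sum_diracs conj_assoc)
  finally show "emeasure (restrict_adjacency B (sum_diracs I x)) Y =
      emeasure (sum_diracs {i \<in> I. x i \<in> (B \<times> B) \<times> UNIV} x) Y" .
qed (simp add: restrict_adjacency_def)

lemma restrict_adjacency_restrict_adjacency:
  assumes "sets \<xi> = sets borel" "B \<in> sets borel" "E \<in> sets borel" "B \<subseteq> E"
  shows "restrict_adjacency B (restrict_adjacency E \<xi>) = restrict_adjacency B \<xi>"
proof -
  have [measurable]: "(B \<times> B) \<times> UNIV \<in> sets \<xi>" "(E \<times> E) \<times> UNIV \<in> sets \<xi>"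
    using borel_set_square_marks assms by auto
  have "indicator ((E \<times> E) \<times> UNIV) x * indicator ((B \<times> B) \<times> UNIV) x =
      (indicator ((B \<times> B) \<times> UNIV) x :: ennreal)" for x :: "('a \<times> 'a) \<times> bool"
    using \<open>B \<subseteq> E\<close> by (auto split: split_indicator)
  then show ?thesis
    unfolding restrict_adjacency_def by (subst density_density_eq) simp_all
qed

text \<open>
  Restricting the graph to \<open>B\<close> keeps the vertices in \<open>B\<close> and numbers them anew in the order of
  their visits.
\<close>

lemma sum_diracs_visits:
  fixes s :: "nat \<Rightarrow> 'a::polish_space"
  assumes inf: "infinite {i. s i \<in> B}" and B: "B \<in> sets borel"
  shows "restrict_adjacency B (sum_diracs {(i, j). enat i < n \<and> enat j < n} (\<lambda>(i, j). ((s i, s j), a i j))) =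
    sum_diracs {(i, j). enat i < visit_count B n s \<and> enat j < visit_count B n s}
      (\<lambda>(i, j). ((visits B s i, visits B s j), a (visit_time B s i) (visit_time B s j)))"
proof -
  let ?\<tau> = "visit_time B s" and ?I = "{(i, j). enat i < visit_count B n s \<and> enat j < visit_count B n s}"
  let ?J = "{p \<in> {(i, j). enat i < n \<and> enat j < n}.
    (case p of (i, j) \<Rightarrow> ((s i, s j), a i j)) \<in> (B \<times> B) \<times> UNIV}"
  let ?g = "\<lambda>(i, j). (?\<tau> i, ?\<tau> j)"
  have inj: "inj_on ?g ?I"
    using strict_mono_imp_inj_on[OF strict_mono_visit_time[OF inf]] by (auto simp: inj_on_def)
  have "?J = ?g ` ?I"
  proof (intro equalityI subsetI)
    fix p assume p: "p \<in> ?J"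
    obtain k l where kl: "p = (k, l)" by (cases p)
    with p have "?\<tau> (visits_before B s k) = k" "?\<tau> (visits_before B s l) = l" "enat k < n" "enat l < n"
      by (auto intro: visit_time_visits_before)
    then show "p \<in> ?g ` ?I"
      unfolding kl by (intro image_eqI[of _ _ "(visits_before B s k, visits_before B s l)"])
        (auto simp flip: visit_time_less_count_iff[OF inf])
  next
    fix p assume "p \<in> ?g ` ?I"
    then show "p \<in> ?J"
      by (auto simp: visit_time_less_count_iff[OF inf] visit_time_in[OF inf])
  qed
  then show ?thesis
    unfolding restrict_adjacency_sum_diracs[OF B]
    by (simp only: sum_diracs_image[OF inj])
      (rule arg_cong2[where f = sum_diracs], auto simp: fun_eq_iff visits_def)
qed

text \<open>
  Passes between the \<open>\<sigma>\<close>-algebras by which i.i.d. representations express independence and the joint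
  laws by which the visits are computed.
\<close>

lemma (in prob_space) indep_set_vimage_algebra_iff:
  assumes X [measurable]: "X \<in> M \<rightarrow>\<^sub>M K" and Y [measurable]: "Y \<in> M \<rightarrow>\<^sub>M L"
  shows "indep_set (sets (vimage_algebra (space M) X K)) (sets (vimage_algebra (space M) Y L)) \<longleftrightarrow>
    distr M K X \<Otimes>\<^sub>M distr M L Y = distr M (K \<Otimes>\<^sub>M L) (\<lambda>\<omega>. (X \<omega>, Y \<omega>))"
    (is "?indep \<longleftrightarrow> ?prod = ?joint")
proof -
  interpret X: prob_space "distr M K X"
    by (rule prob_space_distr) simp
  interpret Y: prob_space "distr M L Y"
    by (rule prob_space_distr) simp
  have sets_X: "sets (vimage_algebra (space M) X K) = {X -` A \<inter> space M |A. A \<in> sets K}"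
    and sets_Y: "sets (vimage_algebra (space M) Y L) = {Y -` A \<inter> space M |A. A \<in> sets L}"
    using measurable_space[OF X] measurable_space[OF Y] by (auto intro!: sets_vimage_algebra2)
  have joint: "emeasure ?joint (A \<times> A') = emeasure M ((X -` A \<inter> space M) \<inter> (Y -` A' \<inter> space M))"
    if "A \<in> sets K" "A' \<in> sets L" for A A'
    using that by (subst emeasure_distr) (auto intro!: arg_cong[where f = "emeasure M"])
  have prod: "emeasure ?prod (A \<times> A') = emeasure M (X -` A \<inter> space M) * emeasure M (Y -` A' \<inter> space M)"
    if "A \<in> sets K" "A' \<in> sets L" for A A'
    using that by (simp add: Y.emeasure_pair_measure_Times emeasure_distr)
  show ?thesis
  proof
    assume ?indep
    show "?prod = ?joint"
    proof (rule pair_measure_eqI)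
      fix A A' assume "A \<in> sets (distr M K X)" "A' \<in> sets (distr M L Y)"
      then have A: "A \<in> sets K" "A' \<in> sets L" by simp_all
      have "prob ((X -` A \<inter> space M) \<inter> (Y -` A' \<inter> space M)) = prob (X -` A \<inter> space M) * prob (Y -` A' \<inter> space M)"
        using A by (intro indep_setD[OF \<open>?indep\<close>]) (auto simp: sets_X sets_Y)
      then show "emeasure (distr M K X) A * emeasure (distr M L Y) A' = emeasure ?joint (A \<times> A')"
        unfolding joint[OF A] using A by (simp add: emeasure_distr emeasure_eq_measure ennreal_mult)
    next
      show "sets (distr M K X \<Otimes>\<^sub>M distr M L Y) = sets ?joint"
        unfolding sets_distr by (rule sets_pair_measure_cong) simp_all
    qed unfold_locales
  next
    assume eq: "?prod = ?joint"
    show ?indep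
    proof (rule indep_setI)
      fix a b assume "a \<in> sets (vimage_algebra (space M) X K)" "b \<in> sets (vimage_algebra (space M) Y L)"
      then obtain A A' where "A \<in> sets K" "A' \<in> sets L" "a = X -` A \<inter> space M" "b = Y -` A' \<inter> space M"
        by (auto simp: sets_X sets_Y)
      then have "emeasure M (a \<inter> b) = emeasure M a * emeasure M b"
        using joint prod eq by metis
      then show "prob (a \<inter> b) = prob a * prob b"
        by (simp add: emeasure_eq_measure flip: ennreal_mult)
    qed (auto simp: sets_X sets_Y)
  qed
qed

text \<open>
  An i.i.d. representation restricts to one on the same probability space: the new vertices are the
  successive points of the whole infinite sequence in \<open>B\<close>, not only of its first \<open>N\<close> terms, so
  that there are almost surely infinitely many of them; the new number of vertices is the number of
  visits to \<open>B\<close> before \<open>N\<close>.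
\<close>

lemma (in prob_space) iid_graph_representation_restrict:
  fixes S :: "nat \<Rightarrow> 'a \<Rightarrow> 'b::polish_space"
  defines "X \<equiv> \<lambda>\<omega> i. S i \<omega>"
  assumes rep: "iid_graph_representation M \<zeta> W N S A \<eta>" and W: "connection_kernel W"
    and B [measurable]: "B \<in> sets borel" and pos: "emeasure \<eta> B \<noteq> 0"
  shows "iid_graph_representation M (restrict_adjacency B \<circ> \<zeta>) W
    (\<lambda>\<omega>. visit_count B (N \<omega>) (X \<omega>)) (\<lambda>i \<omega>. visits B (X \<omega>) i)
    (\<lambda>i j \<omega>. A (visit_time B (X \<omega>) i) (visit_time B (X \<omega>) j) \<omega>) (uniform_measure \<eta> B)"
proof -
  let ?Pi = "\<Pi>\<^sub>M i\<in>(UNIV::nat set). (borel :: 'b measure)" and ?C = "count_space UNIV :: enat measure"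
  let ?K = "\<lambda>\<omega>. visit_count B (N \<omega>) (X \<omega>)" and ?V = "\<lambda>\<omega>. visits B (X \<omega>)"
  let ?A = "\<lambda>i j \<omega>. A (visit_time B (X \<omega>) i) (visit_time B (X \<omega>) j) \<omega>"
  let ?\<eta>B = "uniform_measure \<eta> B"
  from rep have N [measurable]: "N \<in> measurable M (count_space UNIV)"
    and S [measurable]: "S i \<in> borel_measurable M"
    and A [measurable]: "A i j \<in> measurable M (count_space UNIV)"
    and sum: "AE \<omega> in M. \<zeta> \<omega> = sum_diracs {(i, j). enat i < N \<omega> \<and> enat j < N \<omega>}
      (\<lambda>(i, j). ((S i \<omega>, S j \<omega>), A i j \<omega>))"
    and inj: "AE \<omega> in M. inj (\<lambda>i. S i \<omega>)"
    and irrefl: "AE \<omega> in M. \<forall>i. \<not> A i i \<omega>"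
    and sym: "AE \<omega> in M. \<forall>i j. A j i \<omega> = A i j \<omega>"
    and cond: "finite F \<Longrightarrow> F \<subseteq> {(i, j). i < j} \<Longrightarrow>
        (AE \<omega> in M. cond_prob_given M (?C \<Otimes>\<^sub>M ?Pi) (\<lambda>\<omega>'. (N \<omega>', X \<omega>'))
             {\<omega>'\<in>space M. \<forall>(i, j)\<in>F. A i j \<omega>' = b (i, j)} \<omega> =
           (\<Prod>(i, j)\<in>F. if b (i, j) then W (S i \<omega>, S j \<omega>) else 1 - W (S i \<omega>, S j \<omega>)))"
    and indep: "indep_vars (\<lambda>_. borel) S UNIV"
    and law: "distr M borel (S i) = \<eta>"
    and indep_NX: "indep_set (sets (vimage_algebra (space M) N (count_space UNIV)))
       (sets (vimage_algebra (space M) X ?Pi))"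
    for i j F b
    unfolding iid_graph_representation_def graph_representation_def X_def by blast+
  have sets_eta [simp, measurable_cong]: "sets \<eta> = sets borel"
    unfolding law[of 0, symmetric] by simp
  interpret eta: prob_space \<eta>
    unfolding law[of 0, symmetric] by (rule prob_space_distr) simp
  interpret etaB: prob_space ?\<eta>B
    by (rule prob_space_uniform_measure[OF pos]) simp
  have B_eta: "B \<in> sets \<eta>"
    by simp
  have sets_PiQ: "sets (\<Pi>\<^sub>M i\<in>(UNIV::nat set). \<eta>) = sets ?Pi"
    and sets_PiR: "sets (\<Pi>\<^sub>M i\<in>(UNIV::nat set). ?\<eta>B) = sets ?Pi"
    by (auto intro!: sets_PiM_cong)
  have X [measurable]: "X \<in> M \<rightarrow>\<^sub>M ?Pi"
    unfolding X_def by (rule measurable_PiM_single') simp_all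
  have law_X: "distr M ?Pi X = (\<Pi>\<^sub>M i\<in>UNIV. \<eta>)"
    using indep by (subst (asm) indep_vars_iff_distr_eq_PiM) (simp_all add: X_def restrict_UNIV law)
  have "AE s in distr M ?Pi X. infinite {i. s i \<in> B}"
    unfolding law_X by (rule AE_infinite_visits[OF eta.prob_space_axioms B_eta pos])
  from AE_distrD[OF X this] have inf: "AE \<omega> in M. infinite {i. S i \<omega> \<in> B}"
    by (simp add: X_def)

  have "distr M ?C N \<Otimes>\<^sub>M (\<Pi>\<^sub>M i\<in>UNIV. \<eta>) = distr M (?C \<Otimes>\<^sub>M ?Pi) (\<lambda>\<omega>. (N \<omega>, X \<omega>))"
    using indep_NX unfolding indep_set_vimage_algebra_iff[OF N X] law_X .
  also have "\<dots> = distr M (?C \<Otimes>\<^sub>M (\<Pi>\<^sub>M i\<in>UNIV. \<eta>)) (\<lambda>\<omega>. (N \<omega>, X \<omega>))"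
    by (intro distr_cong sets_pair_measure_cong) (simp_all add: sets_PiQ)
  finally have joint_NX: "distr M ?C N \<Otimes>\<^sub>M (\<Pi>\<^sub>M i\<in>UNIV. \<eta>) =
    distr M (?C \<Otimes>\<^sub>M (\<Pi>\<^sub>M i\<in>UNIV. \<eta>)) (\<lambda>\<omega>. (N \<omega>, X \<omega>))" .
  have X_eta: "X \<in> M \<rightarrow>\<^sub>M (\<Pi>\<^sub>M i\<in>UNIV. \<eta>)"
    using X by (simp cong: measurable_cong_sets add: sets_PiQ)
  have "distr M ?C ?K \<Otimes>\<^sub>M (\<Pi>\<^sub>M i\<in>UNIV. ?\<eta>B) = distr M (?C \<Otimes>\<^sub>M (\<Pi>\<^sub>M i\<in>UNIV. ?\<eta>B)) (\<lambda>\<omega>. (?K \<omega>, ?V \<omega>))"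
    by (rule distr_visit_count_visits[OF eta.prob_space_axioms B_eta pos N X_eta joint_NX])
  also have "\<dots> = distr M (?C \<Otimes>\<^sub>M ?Pi) (\<lambda>\<omega>. (?K \<omega>, ?V \<omega>))"
    by (intro distr_cong sets_pair_measure_cong) (simp_all add: sets_PiR)
  finally have joint: "distr M ?C ?K \<Otimes>\<^sub>M (\<Pi>\<^sub>M i\<in>UNIV. ?\<eta>B) = distr M (?C \<Otimes>\<^sub>M ?Pi) (\<lambda>\<omega>. (?K \<omega>, ?V \<omega>))" .
  have V [measurable]: "?V \<in> M \<rightarrow>\<^sub>M ?Pi" and K [measurable]: "?K \<in> M \<rightarrow>\<^sub>M ?C"
    by measurable
  have V_comp [measurable]: "(\<lambda>\<omega>. ?V \<omega> i) \<in> borel_measurable M" for i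
    by (rule measurable_compose[OF V]) simp
  have law_V: "distr M ?Pi ?V = (\<Pi>\<^sub>M i\<in>UNIV. ?\<eta>B)"
  proof (rule measure_eqI)
    fix Y assume "Y \<in> sets (distr M ?Pi ?V)"
    then have Y: "Y \<in> sets ?Pi" by simp
    interpret K: prob_space "distr M ?C ?K"
      by (rule prob_space_distr) simp
    interpret R: prob_space "\<Pi>\<^sub>M i\<in>(UNIV::nat set). ?\<eta>B"
      by (rule prob_space_PiM) (rule etaB.prob_space_axioms)
    have "emeasure (\<Pi>\<^sub>M i\<in>UNIV. ?\<eta>B) Y = emeasure (distr M ?C ?K) UNIV * emeasure (\<Pi>\<^sub>M i\<in>UNIV. ?\<eta>B) Y"
      using K.emeasure_space_1 by simp
    also have "\<dots> = emeasure (distr M ?C ?K \<Otimes>\<^sub>M (\<Pi>\<^sub>M i\<in>UNIV. ?\<eta>B)) (UNIV \<times> Y)"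
      using Y by (subst R.emeasure_pair_measure_Times) (simp_all add: sets_PiR)
    also have "\<dots> = emeasure M ((\<lambda>\<omega>. (?K \<omega>, ?V \<omega>)) -` (UNIV \<times> Y) \<inter> space M)"
      unfolding joint using Y by (intro emeasure_distr) auto
    also have "\<dots> = emeasure (distr M ?Pi ?V) Y"
      using Y by (subst emeasure_distr) (auto intro!: arg_cong[where f = "emeasure M"])
    finally show "emeasure (distr M ?Pi ?V) Y = emeasure (\<Pi>\<^sub>M i\<in>UNIV. ?\<eta>B) Y" ..
  qed (simp add: sets_PiR)
  have law_V_comp: "distr M borel (\<lambda>\<omega>. ?V \<omega> i) = ?\<eta>B" for i
  proof -
    have "distr M borel (\<lambda>\<omega>. ?V \<omega> i) = distr (distr M ?Pi ?V) borel (\<lambda>s. s i)"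
      by (subst distr_distr) (auto simp: comp_def)
    also have "\<dots> = distr (\<Pi>\<^sub>M i\<in>UNIV. ?\<eta>B) ?\<eta>B (\<lambda>s. s i)"
      unfolding law_V by (rule distr_cong) simp_all
    also have "\<dots> = ?\<eta>B"
      by (rule distr_PiM_component[where M = "\<lambda>_. ?\<eta>B"]) (auto intro: etaB.prob_space_axioms)
    finally show ?thesis .
  qed
  have indep_V: "indep_vars (\<lambda>_. borel) (\<lambda>i \<omega>. ?V \<omega> i) UNIV"
    by (subst indep_vars_iff_distr_eq_PiM) (simp_all add: restrict_UNIV law_V_comp law_V[symmetric])
  have indep_KV: "indep_set (sets (vimage_algebra (space M) ?K ?C)) (sets (vimage_algebra (space M) ?V ?Pi))"
    unfolding indep_set_vimage_algebra_iff[OF K V] law_V by (rule joint)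

  have sum': "AE \<omega> in M. (restrict_adjacency B \<circ> \<zeta>) \<omega> =
      sum_diracs {(i, j). enat i < ?K \<omega> \<and> enat j < ?K \<omega>} (\<lambda>(i, j). ((?V \<omega> i, ?V \<omega> j), ?A i j \<omega>))"
    using sum inf
  proof eventually_elim
    case (elim \<omega>)
    then show ?case
      using sum_diracs_visits[OF _ B, of "X \<omega>" "N \<omega>" "\<lambda>i j. A i j \<omega>"] by (simp add: X_def)
  qed
  have inj': "AE \<omega> in M. inj (\<lambda>i. ?V \<omega> i)"
    using inj inf
  proof eventually_elim
    case (elim \<omega>)
    then have "inj (visit_time B (X \<omega>))"
      by (intro strict_mono_imp_inj_on strict_mono_visit_time) (simp add: X_def)
    with elim(1) have "inj (X \<omega> \<circ> visit_time B (X \<omega>))"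
      by (intro inj_compose) (simp_all add: X_def)
    then show ?case
      by (simp add: comp_def visits_def[abs_def])
  qed
  have A': "?A i j \<in> measurable M (count_space UNIV)" for i j
    by (rule measurable_compose_countable2[where f = A]) measurable
  show ?thesis
    unfolding iid_graph_representation_def graph_representation_def
  proof (intro conjI allI impI)
    show "AE \<omega> in M. \<forall>i. \<not> ?A i i \<omega>" "AE \<omega> in M. \<forall>i j. ?A j i \<omega> = ?A i j \<omega>"
      using irrefl sym by auto
    fix F :: "(nat \<times> nat) set" and b
    assume "finite F \<and> F \<subseteq> {(i, j). i < j}"
    then show "AE \<omega> in M. cond_prob_given M (?C \<Otimes>\<^sub>M ?Pi) (\<lambda>\<omega>'. (?K \<omega>', \<lambda>i. ?V \<omega>' i))
             {\<omega>'\<in>space M. \<forall>(i, j)\<in>F. ?A i j \<omega>' = b (i, j)} \<omega> =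
           (\<Prod>(i, j)\<in>F. if b (i, j) then W (?V \<omega> i, ?V \<omega> j) else 1 - W (?V \<omega> i, ?V \<omega> j))"
      unfolding X_def by (intro cond_prob_given_visits[OF B W N S A inf] cond[unfolded X_def]) auto
  qed (use K V_comp A' sum' inj' indep_V law_V_comp indep_KV in simp_all)
qed

lemma iid_graph_representation_cong_AE:
  assumes "iid_graph_representation P \<zeta> W N S A \<eta>" "AE \<omega> in P. \<zeta>' \<omega> = \<zeta> \<omega>"
  shows "iid_graph_representation P \<zeta>' W N S A \<eta>"
proof -
  have "AE \<omega> in P. \<zeta>' \<omega> = sum_diracs {(i, j). enat i < N \<omega> \<and> enat j < N \<omega>}
      (\<lambda>(i, j). ((S i \<omega>, S j \<omega>), A i j \<omega>))"
    if "AE \<omega> in P. \<zeta> \<omega> = sum_diracs {(i, j). enat i < N \<omega> \<and> enat j < N \<omega>}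
      (\<lambda>(i, j). ((S i \<omega>, S j \<omega>), A i j \<omega>))"
    using that assms(2) by eventually_elim simp
  with assms(1) show ?thesis
    unfolding iid_graph_representation_def graph_representation_def by blast
qed

lemma AE_extend_space:
  assumes "AE \<omega> in M. Q \<omega>"
  shows "AE \<omega> in extend_space M. Q (fst \<omega>)"
proof -
  interpret U: prob_space unit_lebesgue
    by (rule prob_space_unit_lebesgue)
  have "AE \<omega> in distr (M \<Otimes>\<^sub>M unit_lebesgue) M fst. Q \<omega>"
    unfolding U.distr_pair_fst by (rule assms)
  then show ?thesis
    unfolding extend_space_def by (rule AE_distrD[OF measurable_fst])
qed

lemma AE_extend_spaceD:
  assumes "prob_space M" "AE \<omega> in extend_space M. Q (fst \<omega>)"
  shows "AE \<omega> in M. Q \<omega>"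
proof -
  interpret M: prob_space M by fact
  interpret U: prob_space unit_lebesgue
    by (rule prob_space_unit_lebesgue)
  interpret pair_sigma_finite M unit_lebesgue ..
  have "AE \<omega> in M. AE u in unit_lebesgue. Q (fst (\<omega>, u))"
    by (rule AE_pair[OF assms(2)[unfolded extend_space_def]])
  then show ?thesis
    by simp
qed

lemma prob_space_extend_space:
  assumes "prob_space M"
  shows "prob_space (extend_space M)"
proof -
  interpret M: prob_space M by fact
  interpret U: prob_space unit_lebesgue
    by (rule prob_space_unit_lebesgue)
  interpret pair_prob_space M unit_lebesgue ..
  show ?thesis
    unfolding extend_space_def by unfold_locales
qed

text \<open>
  Restricting \<open>\<xi>|\<^sub>E\<close> to \<open>B\<close> gives \<open>\<xi>|\<^sub>B\<close>, so the visits to \<open>B\<close> in a representation of \<open>\<xi>|\<^sub>E\<close>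
  represent \<open>\<xi>|\<^sub>B\<close>. In symbols, \<open>\<eta>\<^sub>B = \<eta>\<^sub>E(\<cdot> | B)\<close>.
\<close>

theorem vertex_law_uniform_measure:
  fixes \<xi> :: "'w \<Rightarrow> (('a::polish_space \<times> 'a) \<times> bool) measure"
  assumes "prob_space M" and W: "connection_kernel W" and \<xi>: "AE \<omega> in M. sets (\<xi> \<omega>) = sets borel"
    and B: "B \<in> sets borel" and E: "E \<in> sets borel" and "B \<subseteq> E"
    and law: "vertex_law M \<xi> W E \<eta>" and pos: "emeasure \<eta> B \<noteq> 0"
  shows "vertex_law M \<xi> W B (uniform_measure \<eta> B)"
proof -
  interpret P: prob_space "extend_space M"
    by (rule prob_space_extend_space) fact
  from law obtain N S A where
    rep: "iid_graph_representation (extend_space M) (restrict_adjacency E \<circ> \<xi> \<circ> fst) W N S A \<eta>"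
    unfolding vertex_law_def by blast
  then have "distr (extend_space M) borel (S 0) = \<eta>" "S 0 \<in> borel_measurable (extend_space M)"
    unfolding iid_graph_representation_def graph_representation_def by blast+
  then interpret eta: prob_space \<eta>
    using P.prob_space_distr by blast
  have "AE \<omega> in extend_space M. (restrict_adjacency B \<circ> \<xi> \<circ> fst) \<omega> =
      (restrict_adjacency B \<circ> (restrict_adjacency E \<circ> \<xi> \<circ> fst)) \<omega>"
    using AE_extend_space[OF \<xi>]
    by eventually_elim (simp add: restrict_adjacency_restrict_adjacency B E \<open>B \<subseteq> E\<close>)
  note rep' = iid_graph_representation_cong_AE[OF P.iid_graph_representation_restrict[OF rep W B pos] this]
  show ?thesis
    unfolding vertex_law_def
  proof (intro conjI)
    show "emeasure (uniform_measure \<eta> B) B = 1"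
      using pos by (simp add: emeasure_uniform_measure_1)
  qed (intro exI, rule rep')
qed

section \<open>The vertex law charges the sets hit by the directing process\<close>

lemma sigma_finite_locally_finite:
  fixes \<mu> :: "'a::metric_space measure"
  assumes "locally_finite \<mu>"
  shows "sigma_finite_measure \<mu>"
proof
  have sets: "sets \<mu> = sets borel" and fin: "A \<in> sets borel \<Longrightarrow> bounded A \<Longrightarrow> emeasure \<mu> A < \<infinity>" for A
    using assms by (auto simp: locally_finite_def)
  let ?C = "range (\<lambda>n::nat. cball (undefined :: 'a) (real n))"
  have "x \<in> \<Union> ?C" for x
    using real_arch_simple[of "dist undefined x"] by auto
  then have "\<Union> ?C = space \<mu>"
    using sets_eq_imp_space_eq[OF sets] by auto
  then show "\<exists>C. countable C \<and> C \<subseteq> sets \<mu> \<and> \<Union> C = space \<mu> \<and> (\<forall>a\<in>C. emeasure \<mu> a \<noteq> \<infinity>)"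
    using fin by (intro exI[of _ ?C]) (auto simp: sets less_top[symmetric])
qed

lemma measurable_emeasure_random_measure:
  assumes "random_measure M \<nu>" "B \<in> sets borel"
  shows "(\<lambda>\<omega>. emeasure (\<nu> \<omega>) B) \<in> borel_measurable M"
proof -
  have "(\<lambda>\<mu>. emeasure \<mu> B) \<in> borel_measurable locally_finite_algebra"
    unfolding locally_finite_algebra_def
    using assms(2) by (intro measurable_Sup1[where m = "vimage_algebra {\<mu>. locally_finite \<mu>} (\<lambda>\<mu>. emeasure \<mu> B) borel"])
      (auto intro: measurable_vimage_algebra1)
  with assms(1) show ?thesis
    unfolding random_measure_def by (rule measurable_compose)
qed

text \<open>
  If \<open>\<eta> B = 0\<close>, then almost surely no vertex lies in \<open>B\<close>, so \<open>\<nu>(B)\<^sup>2 = \<xi>(B \<times> B \<times> {0,1}) = 0\<close>,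
  against the assumption that \<open>\<nu>\<close> hits \<open>B\<close> with positive probability.
\<close>

lemma vertex_law_pos:
  fixes \<xi> :: "'w \<Rightarrow> (('a::polish_space \<times> 'a) \<times> bool) measure"
  assumes "prob_space M" and dir: "directing_process M \<xi> \<nu>"
    and B: "B \<in> sets borel" and E: "E \<in> sets borel" and "B \<subseteq> E"
    and law: "vertex_law M \<xi> W E \<eta>"
    and hit: "\<P>(\<omega> in M. emeasure (\<nu> \<omega>) B = 0) < 1"
  shows "emeasure \<eta> B \<noteq> 0"
proof
  assume null: "emeasure \<eta> B = 0"
  interpret M: prob_space M by fact
  from law obtain N S A where
    rep: "iid_graph_representation (extend_space M) (restrict_adjacency E \<circ> \<xi> \<circ> fst) W N S A \<eta>"
    unfolding vertex_law_def by blast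
  then have S: "S i \<in> borel_measurable (extend_space M)"
    and law_S: "distr (extend_space M) borel (S i) = \<eta>"
    and sum: "AE \<omega> in extend_space M. restrict_adjacency E (\<xi> (fst \<omega>)) =
      sum_diracs {(i, j). enat i < N \<omega> \<and> enat j < N \<omega>} (\<lambda>(i, j). ((S i \<omega>, S j \<omega>), A i j \<omega>))" for i
    unfolding iid_graph_representation_def graph_representation_def by auto
  have sets_eta: "sets \<eta> = sets borel"
    unfolding law_S[of 0, symmetric] by simp
  have "AE x in \<eta>. x \<notin> B"
    using null B sets_eta by (intro AE_not_in) (simp add: null_sets_def)
  then have "AE \<omega> in extend_space M. S i \<omega> \<notin> B" for i
    unfolding law_S[of i, symmetric] by (rule AE_distrD[OF S])
  then have "AE \<omega> in extend_space M. \<forall>i. S i \<omega> \<notin> B"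
    unfolding AE_all_countable by blast
  moreover have "AE \<omega> in extend_space M. directed_by (\<xi> (fst \<omega>)) (\<nu> (fst \<omega>))"
    using dir by (intro AE_extend_space) (simp add: directing_process_def)
  ultimately have "AE \<omega> in extend_space M. emeasure (\<nu> (fst \<omega>)) B = 0"
    using sum
  proof eventually_elim
    case (elim \<omega>)
    let ?\<xi> = "\<xi> (fst \<omega>)" and ?\<nu> = "\<nu> (fst \<omega>)" and ?BB = "(B \<times> B) \<times> (UNIV :: bool set)"
    from elim(2) have sets_\<xi>: "sets ?\<xi> = sets borel" and lf: "locally_finite ?\<nu>"
      and prod: "emeasure ?\<xi> (D \<times> UNIV) = emeasure (?\<nu> \<Otimes>\<^sub>M ?\<nu>) D" if "D \<in> sets borel" for D
      using that by (auto simp: directed_by_def simple_measure_def locally_finite_def)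
    interpret nu: sigma_finite_measure ?\<nu>
      by (rule sigma_finite_locally_finite) (rule lf[OF sets.empty_sets])
    have B_nu: "B \<in> sets ?\<nu>"
      using lf[OF sets.empty_sets] B by (simp add: locally_finite_def)
    have "B \<times> B \<in> sets (borel \<Otimes>\<^sub>M borel)"
      using B by simp
    then have "B \<times> B \<in> sets borel"
      by (simp only: borel_prod)
    then have "emeasure ?\<nu> B * emeasure ?\<nu> B = emeasure ?\<xi> ?BB"
      using B_nu by (simp add: prod nu.emeasure_pair_measure_Times)
    also have "\<dots> = emeasure (restrict_adjacency E ?\<xi>) ?BB"
      using \<open>B \<subseteq> E\<close> borel_set_square_marks[OF B] borel_set_square_marks[OF E] sets_\<xi>[OF sets.empty_sets]
      unfolding restrict_adjacency_def
      by (subst emeasure_restricted) (auto intro!: arg_cong[where f = "emeasure ?\<xi>"])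
    also have "\<dots> = 0"
      using elim(1) borel_set_square_marks[OF B] unfolding elim(3)
      by (subst emeasure_sum_diracs) (auto simp: split_beta)
    finally show ?case
      by simp
  qed
  then have "AE \<omega> in M. emeasure (\<nu> \<omega>) B = 0"
    by (rule AE_extend_spaceD[OF \<open>prob_space M\<close>])
  moreover have "{\<omega> \<in> space M. emeasure (\<nu> \<omega>) B = 0} \<in> sets M"
    using measurable_emeasure_random_measure[of M \<nu> B] dir B
    by (simp add: directing_process_def)
  ultimately have "\<P>(\<omega> in M. emeasure (\<nu> \<omega>) B = 0) = 1"
    by (simp add: M.prob_Collect_eq_1)
  with hit show False
    by simp
qed

section \<open>Sampling functions on subsets\<close>

theorem proposition26:
  fixes M :: "'w measure"
    and \<xi> :: "'w \<Rightarrow> (('a::polish_space \<times> 'a) \<times> bool) measure"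
    and \<nu> :: "'w \<Rightarrow> 'a measure"
    and W :: "'a \<times> 'a \<Rightarrow> real"
    and B C :: "'a set"
    and f :: "real \<Rightarrow> 'a"
  assumes "prob_space M"
    and "connection_kernel W"
    and "graph_process M \<xi> W"
    and "boundedly_exchangeable M \<xi> \<nu>"
    and "B \<in> sets borel" and "bounded B"
    and "C \<in> sets borel" and "bounded C"
    and "B \<inter> C = {}"
    and "\<P>(\<omega> in M. emeasure (\<nu> \<omega>) B = 0) < 1"
    and "sampling_function M \<xi> W (B \<union> C) f"
  shows "sampling_function M \<xi> W B (f \<circ> T_map f B)"
proof -
  from assms(11) have f: "f \<in> borel_measurable unit_lebesgue"
    and law: "vertex_law M \<xi> W (B \<union> C) (distr unit_lebesgue borel f)"
    by (auto simp: sampling_function_def)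
  have dir: "directing_process M \<xi> \<nu>"
    using assms(4) by (simp add: boundedly_exchangeable_def)
  have BC: "B \<union> C \<in> sets borel"
    using assms(5,7) by simp
  have pos: "emeasure (distr unit_lebesgue borel f) B \<noteq> 0"
    by (rule vertex_law_pos[OF assms(1) dir assms(5) BC _ law assms(10)]) simp
  have "AE \<omega> in M. sets (\<xi> \<omega>) = sets borel"
    using dir unfolding directing_process_def
    by (auto simp: directed_by_def simple_measure_def locally_finite_def)
  then have "vertex_law M \<xi> W B (uniform_measure (distr unit_lebesgue borel f) B)"
    by (rule vertex_law_uniform_measure[OF assms(1,2) _ assms(5) BC _ law pos]) simp
  then show ?thesis
    using measurable_comp_T_map[OF f assms(5) pos] distr_comp_T_map[OF f assms(5) pos]
    by (simp add: sampling_function_def)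
qed

end
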